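(* Let $\mathbb{K}$ be a field with characteristic different from $2$, let $\alpha \in \mathbb{K}\setminus\{0\}$, let $n \geq 1$ and let $A \in \mathrm{M}_n(\mathbb{K})$. Then $A$ is an $(\alpha,\alpha)$-composite (in $\mathrm{M}_n(\mathbb{K})$) if and only if all the following conditions hold: (i) The sequences $(n_k(A,0))_{k \geq 1}$ and $(n_k(A,2\alpha))_{k \geq 1}$ are intertwined. (ii) For every $\lambda \in \overline{\mathbb{K}} \setminus \{0,\alpha,2\alpha\}$ and every integer $k \geq 1$, $j_k(A,\lambda)=j_k(A,2\alpha-\lambda)$.
   Context: $\overline{\mathbb{K}}$ is an algebraic closure of $\mathbb{K}$. For scalars $a,b \in \mathbb{K}\setminus\{0\}$, an element $x$ of a $\mathbb{K}$-algebra $\mathcal{A}$ is an $(a,b)$-composite if there are idempotents $p,q \in \mathcal{A}$ (i.e. $p^2=p$, $q^2=q$) with $x = a p + b q$. For $A \in \mathrm{M}_n(\mathbb{K})$, $\lambda\in\overline{\mathbb{K}}$ and an integer $k\geq 1$, $n_k(A,\lambda) := \dim \operatorname{Ker}(A-\lambda I_n)^k - \dim\operatorname{Ker}(A-\lambda I_n)^{k-1}$ (dimensions over $\overline{\mathbb{K}}$), i.e. the number of Jordan blocks of size at least $k$ for $\lambda$ in the Jordan reduction of $A$ over $\overline{\mathbb{K}}$ (zero if $\lambda$ is not an eigenvalue); $j_k(A,\lambda)$ is the number of Jordan blocks of size exactly $k$ for $\lambda$ in that Jordan reduction. Two sequences $(u_k)_{k\geq 1}$ and $(v_k)_{k\geq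 1}$ are intertwined if for all $k \geq 1$: $v_{k+1} \leq u_k$ and $u_{k+1} \leq v_k$. *)

theory Defs
  imports
    "HOL-Algebra.Algebraic_Closure_Type"
    "Jordan_Normal_Form.Jordan_Normal_Form_Uniqueness"
begin

text \<open>
  \<open>M\<^sub>n(K)\<close> is the carrier \<open>carrier_mat n n\<close> of the matrix type over the field \<open>'a\<close>, and the
  algebraic closure of \<open>'a\<close> is the type \<open>'a alg_closure\<close> with embedding \<^const>\<open>to_ac\<close>.
\<close>

definition mat_composite :: "nat \<Rightarrow> 'a::field \<Rightarrow> 'a \<Rightarrow> 'a mat \<Rightarrow> bool" where
  "mat_composite n a b A \<longleftrightarrow>
     (\<exists>P\<in>carrier_mat n n. \<exists>Q\<in>carrier_mat n n.
        P * P = P \<and> Q * Q = Q \<and> A = a \<cdot>\<^sub>m P + b \<cdot>\<^sub>m Q)"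

abbreviation mat_ac :: "'a::field mat \<Rightarrow> 'a alg_closure mat" where
  "mat_ac A \<equiv> map_mat to_ac A"

text \<open>
  \<open>dim_gen_eigenspace B ev k\<close> is the dimension of the kernel of \<open>(B - ev I)\<^sup>k\<close>. These kernels
  increase with \<open>k\<close>, so the subtraction on \<^typ>\<open>nat\<close> does not truncate. Meaningful for \<open>k \<ge> 1\<close>.
\<close>

definition nblocks_ge :: "nat \<Rightarrow> 'a::field mat \<Rightarrow> 'a alg_closure \<Rightarrow> nat" where
  "nblocks_ge k A ev =
     dim_gen_eigenspace (mat_ac A) ev k - dim_gen_eigenspace (mat_ac A) ev (k - 1)"

text \<open>
  A Jordan reduction is encoded as a list of pairs (block size, eigenvalue). Any choice gives the
  same count; see \<open>nblocks_eq_unique\<close> below.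
\<close>

definition nblocks_eq :: "nat \<Rightarrow> 'a::field mat \<Rightarrow> 'a alg_closure \<Rightarrow> nat" where
  "nblocks_eq k A ev = count_list (SOME bs. jordan_nf (mat_ac A) bs) (k, ev)"

lemma nblocks_eq_unique:
  assumes "jordan_nf (mat_ac A) bs" and "k \<ge> 1"
  shows "nblocks_eq k A ev = count_list bs (k, ev)"
proof -
  have eq: "count_list cs x = length (filter ((=) x) cs)"
    for x :: "nat \<times> 'a alg_closure" and cs
    by (induction cs) auto
  have some: "jordan_nf (mat_ac A) (SOME bs. jordan_nf (mat_ac A) bs)"
    using assms(1) by (rule someI)
  have k: "k \<noteq> 0"
    using assms(2) by simp
  show ?thesis
    unfolding nblocks_eq_def eq
      compute_nr_of_jordan_blocks[OF some k, symmetric]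
      compute_nr_of_jordan_blocks[OF assms(1) k, symmetric] ..
qed

text \<open>Sequences are indexed from \<open>1\<close>; the value at \<open>0\<close> is irrelevant.\<close>

definition intertwined :: "(nat \<Rightarrow> nat) \<Rightarrow> (nat \<Rightarrow> nat) \<Rightarrow> bool" where
  "intertwined u v \<longleftrightarrow> (\<forall>k\<ge>1. v (k + 1) \<le> u k \<and> u (k + 1) \<le> v k)"

end

theory Submission
  imports Defs "Jordan_Normal_Form.Jordan_Normal_Form_Existence" "Jordan_Normal_Form.DL_Rank"
begin

text \<open>
  Put \<open>c = 2\<alpha>\<close>. If \<open>A = \<alpha>P + \<alpha>Q\<close> with idempotents \<open>P\<close>, \<open>Q\<close>, then \<open>S = \<alpha>(P - Q)\<close> satisfies
  \<open>S A = (c - A) S\<close> and \<open>S\<^sup>2 = A (c - A)\<close>. Conversely every such \<^emph>\<open>skew root\<close> \<open>S\<close> gives back the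
  idempotents \<open>(A + S)/c\<close> and \<open>(A - S)/c\<close> (lemma \<open>mat_composite_iff_skew_root\<close>). The theorem thus
  asks which matrices have a skew root, and \<open>\<alpha>\<close> survives only through the reflection \<open>t \<mapsto> c - t\<close>.

  The number of Jordan blocks of size at least \<open>k + 1\<close> for \<open>e\<close> is the dimension of the space
  \<open>W e k\<close> of all eigenvectors for \<open>e\<close> that lie in the image of \<open>(A - e)\<^sup>k\<close>.

  \<^emph>\<open>Necessity.\<close> A skew root maps \<open>W e k\<close> into \<open>W (c - e) k\<close>, and its square is multiplication by
  \<open>e (c - e)\<close> there. For \<open>e\<close> different from \<open>0\<close> and \<open>c\<close> it is therefore injective in both
  directions and the dimensions agree. For \<open>e\<close> in \<open>{0, c}\<close> the square vanishes. Then \<open>S\<close> maps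
  \<open>W e (k + 1)\<close> into the kernel of \<open>S\<close> on \<open>W (c - e) k\<close>, while the kernel of \<open>S\<close> on
  \<open>W e (k + 1)\<close> consists of \<open>S\<close>-images of vectors of \<open>W (c - e) k\<close>. Two applications of the
  rank-nullity theorem give \<open>dim W e (k + 1) \<le> dim W (c - e) k\<close>, which is the intertwining.

  \<^emph>\<open>Sufficiency.\<close> The base field need not contain the eigenvalues, so a rational decomposition
  takes the place of the Jordan form. On a cyclic module \<open>K[t]/(d)\<close>, where \<open>A\<close> acts as
  multiplication by \<open>t\<close>, the map \<open>f(t) \<mapsto> g(t) f(c - t)\<close> is a skew root if
  \<open>g(t) g(c - t) = t (c - t)\<close>, and it is well defined if \<open>d\<close> divides \<open>g(t) d(c - t)\<close>. The choices
  \<open>g = t\<close> and \<open>g = c - t\<close> cover all \<open>d\<close> whose root multiplicities in the algebraic closure are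
  symmetric under \<open>e \<mapsto> c - e\<close>, except that the multiplicities of \<open>0\<close> and \<open>c\<close> may differ by one
  (lemma \<open>skew_divisor_exists\<close>). If \<open>d\<close> is the minimal polynomial, then the multiplicity of a root
  \<open>e\<close> of \<open>d\<close> is the size of the largest Jordan block for \<open>e\<close>. The conditions of the theorem relate
  these sizes in just this way, and they persist after the removal of one largest
  block for every eigenvalue (lemma \<open>balanced_top_order\<close>). So a cyclic summand with annihilator
  \<open>d\<close> is split off, equipped with a skew root, and the rest is treated by induction.

  A cyclic summand is not described by a change of basis but by a projection that is a polynomial
  expression in \<open>A\<close>, a vector \<open>v\<close> and a functional \<open>w\<close>: if \<open>d\<close> is monic of degree \<open>m\<close> and
  annihilates \<open>v\<close> and \<open>w\<close>, and if \<open>w A\<^sup>i v\<close> is \<open>0\<close> for \<open>i < m - 1\<close> and \<open>1\<close> for \<open>i = m - 1\<close>, then the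
  projection is the sum of all \<open>d\<^bsub>i+j+1\<^esub> A\<^sup>i v w A\<^sup>j\<close>. All objects keep the size \<open>n \<times> n\<close>, and the
  formula is compatible with the passage to the algebraic closure, where the blocks are counted.
\<close>

section \<open>Dimensions of subspaces of column vectors\<close>

definition vec_subspace :: "nat \<Rightarrow> 'a::field vec set \<Rightarrow> bool" where
  "vec_subspace n W \<longleftrightarrow> W \<subseteq> carrier_vec n \<and> 0\<^sub>v n \<in> W \<and>
     (\<forall>x\<in>W. \<forall>y\<in>W. x + y \<in> W) \<and> (\<forall>a. \<forall>x\<in>W. a \<cdot>\<^sub>v x \<in> W)"

definition dim_sub :: "nat \<Rightarrow> 'a::field vec set \<Rightarrow> nat" where
  "dim_sub n W = vectorspace.dim class_ring ((module_vec TYPE('a) n)\<lparr>carrier := W\<rparr>)"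

lemma vec_subspace_imp_subspace:
  assumes "vec_subspace n (W :: 'a::field vec set)"
  shows "subspace class_ring W (module_vec TYPE('a) n)"
proof -
  interpret vec_space "TYPE('a)" n .
  show ?thesis
    unfolding subspace_def
    by (intro conjI vectorspace_axioms, unfold submodule_def)
      (use assms module_axioms in \<open>auto simp: vec_subspace_def module_vec_simps class_ring_simps\<close>)
qed

lemma vec_subspace_vectorspace:
  assumes "vec_subspace n (W :: 'a::field vec set)"
  shows "vectorspace class_ring ((module_vec TYPE('a) n)\<lparr>carrier := W\<rparr>)"
proof -
  interpret vec_space "TYPE('a)" n .
  show ?thesis using subspace_is_vs[OF vec_subspace_imp_subspace[OF assms]] .
qed

text \<open>
  An independent subset of \<open>W\<close> is independent in the ambient space, so its size is at most \<open>n\<close>; a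
  maximal one generates \<open>W\<close>.
\<close>

lemma vec_subspace_fin_dim:
  assumes "vec_subspace n (W :: 'a::field vec set)"
  shows "vectorspace.fin_dim class_ring ((module_vec TYPE('a) n)\<lparr>carrier := W\<rparr>)"
proof -
  interpret V: vec_space "TYPE('a)" n .
  let ?W = "V.V\<lparr>carrier := W\<rparr>"
  interpret W: vectorspace class_ring ?W by (rule vec_subspace_vectorspace[OF assms])
  have sub: "submodule class_ring W V.V"
    using vec_subspace_imp_subspace[OF assms] by (simp add: subspace_def)
  have W: "W \<subseteq> carrier_vec n" using assms by (simp add: vec_subspace_def)
  have li: "W.lin_dep A = V.lin_dep A" if "A \<subseteq> W" for A
    using V.span_li_not_depend(2)[OF that sub] .
  have "\<exists>A. finite A \<and> maximal A (\<lambda>S. S \<subseteq> carrier ?W \<and> W.lin_indpt S)"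
  proof (rule maximal_exists[where N = V.dim and B = "{}"])
    fix A assume "A \<subseteq> carrier ?W \<and> W.lin_indpt A"
    hence "A \<subseteq> carrier_vec n" "V.lin_indpt A" using W li by (auto simp: module_vec_simps)
    from V.li_le_dim[OF V.fin_dim this] show "finite A \<and> card A \<le> V.dim" by simp
  qed (auto simp: W.lin_dep_def)
  then obtain A where A: "finite A" "maximal A (\<lambda>S. S \<subseteq> carrier ?W \<and> W.lin_indpt S)" by blast
  with W.max_li_is_gen[OF A(2)] show ?thesis
    unfolding W.fin_dim_def by (auto simp: maximal_def)
qed

text \<open>
  The rank-nullity theorem for the restriction of \<open>M\<close> to \<open>W\<close>. All dimension counts below rest on it.
\<close>

lemma dim_sub_mult_mat:
  fixes M :: "'a::field mat"
  assumes M: "M \<in> carrier_mat n n" and W: "vec_subspace n W"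
  shows "dim_sub n W = dim_sub n ((*\<^sub>v) M ` W) + dim_sub n {x \<in> W. M *\<^sub>v x = 0\<^sub>v n}"
proof -
  interpret V: vec_space "TYPE('a)" n .
  let ?W = "V.V\<lparr>carrier := W\<rparr>"
  interpret W: vectorspace class_ring ?W by (rule vec_subspace_vectorspace[OF W])
  have sub: "x \<in> W \<Longrightarrow> x \<in> carrier_vec n" for x using W by (auto simp: vec_subspace_def)
  interpret L: linear_map class_ring ?W V.V "\<lambda>x. M *\<^sub>v x"
    apply unfold_locales
    using M by (auto simp: module_hom_def module_vec_simps mult_add_distrib_mat_vec[OF M] mult_mat_vec[OF M] dest!: sub)
  have im: "L.imT = (*\<^sub>v) M ` W" by (auto simp: L.im_def)
  have ker: "L.kerT = {x \<in> W. M *\<^sub>v x = 0\<^sub>v n}" by (auto simp: L.ker_def module_vec_simps)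
  show ?thesis
    using L.rank_nullity[OF vec_subspace_fin_dim[OF W]] unfolding im ker dim_sub_def by simp
qed

lemma dim_sub_mono:
  assumes "vec_subspace n W" "vec_subspace n (W' :: 'a::field vec set)" "W \<subseteq> W'"
  shows "dim_sub n W \<le> dim_sub n W'"
proof -
  interpret V: vec_space "TYPE('a)" n .
  let ?W = "V.V\<lparr>carrier := W'\<rparr>"
  interpret W: vectorspace class_ring ?W by (rule vec_subspace_vectorspace[OF assms(2)])
  have "subspace class_ring W ?W"
    unfolding subspace_def
    by (intro conjI W.vectorspace_axioms, unfold submodule_def)
      (use assms W.module_axioms in \<open>auto simp: vec_subspace_def module_vec_simps class_ring_simps\<close>)
  from W.subspace_dim[OF this vec_subspace_fin_dim[OF assms(2)]] vec_subspace_fin_dim[OF assms(1)]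
  show ?thesis by (simp add: dim_sub_def)
qed

lemma dim_sub_zero: "dim_sub n {0\<^sub>v n :: 'a::field vec} = 0"
proof -
  interpret V: vec_space "TYPE('a)" n .
  have s: "vec_subspace n {0\<^sub>v n :: 'a vec}" by (auto simp: vec_subspace_def)
  interpret W: vectorspace class_ring "V.V\<lparr>carrier := {0\<^sub>v n :: 'a vec}\<rparr>"
    by (rule vec_subspace_vectorspace[OF s])
  have "W.span {0\<^sub>v n} = {0\<^sub>v n}"
    using W.span_is_subset2[of "{0\<^sub>v n}"] W.in_own_span[of "{0\<^sub>v n}"] by auto
  thus ?thesis unfolding dim_sub_def
    by (intro W.dim0I) (simp add: module_vec_simps)
qed

lemma dim_sub_line:
  fixes x :: "'a::field vec"
  assumes x: "x \<in> carrier_vec n" and x0: "x \<noteq> 0\<^sub>v n"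
  shows "dim_sub n (range (\<lambda>a. a \<cdot>\<^sub>v x)) = 1"
proof -
  interpret V: vec_space "TYPE('a)" n .
  let ?W = "range (\<lambda>a. a \<cdot>\<^sub>v x)"
  have 0: "0\<^sub>v n = 0 \<cdot>\<^sub>v x" using x by auto
  have s: "vec_subspace n ?W"
    unfolding vec_subspace_def
  proof (intro conjI allI ballI)
    show "?W \<subseteq> carrier_vec n" using x by auto
    show "0\<^sub>v n \<in> ?W" using 0 by (rule range_eqI[where x = 0])
    show "y + z \<in> ?W" if "y \<in> ?W" "z \<in> ?W" for y z
      using that by (auto simp: add_smult_distrib_vec[symmetric])
    show "a \<cdot>\<^sub>v y \<in> ?W" if "y \<in> ?W" for a y
      using that by (auto simp: smult_smult_assoc)
  qed
  interpret W: vectorspace class_ring "V.V\<lparr>carrier := ?W\<rparr>"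
    by (rule vec_subspace_vectorspace[OF s])
  have xW: "x \<in> ?W" by (rule range_eqI[of _ _ 1]) simp
  have "subspace class_ring (W.span {x}) (V.V\<lparr>carrier := ?W\<rparr>)"
    using xW by (intro W.span_is_subspace) auto
  hence sm: "submodule class_ring (W.span {x}) (V.V\<lparr>carrier := ?W\<rparr>)"
    by (simp add: subspace_def)
  have "x \<in> W.span {x}" using W.in_own_span[of "{x}"] xW by auto
  hence "?W \<subseteq> W.span {x}"
    using submodule.smult_closed[OF sm] by (auto simp: module_vec_simps)
  moreover have "W.span {x} \<subseteq> ?W" using W.span_is_subset2[of "{x}"] xW by auto
  ultimately show ?thesis unfolding dim_sub_def
    using xW x0 by (intro W.dim1I[of x]) (auto simp: module_vec_simps)
qed

section \<open>Jordan blocks counted by eigenvectors in the image of a power\<close>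

lemma pow_mat_Suc_left:
  assumes "U \<in> carrier_mat n n"
  shows "U ^\<^sub>m Suc k = U * U ^\<^sub>m k"
proof (induction k)
  case (Suc k)
  have "U ^\<^sub>m Suc (Suc k) = (U * U ^\<^sub>m k) * U" using Suc by simp
  also have "\<dots> = U * (U ^\<^sub>m k * U)"
    using assms by (intro assoc_mult_mat[of _ n n _ n _ n]) auto
  finally show ?case by simp
qed (use assms in auto)

lemma pow_mat_Suc_vec:
  assumes "U \<in> carrier_mat n n" "x \<in> carrier_vec n"
  shows "U ^\<^sub>m Suc k *\<^sub>v x = U *\<^sub>v (U ^\<^sub>m k *\<^sub>v x)"
    and "U ^\<^sub>m Suc k *\<^sub>v x = U ^\<^sub>m k *\<^sub>v (U *\<^sub>v x)"
proof -
  show "U ^\<^sub>m Suc k *\<^sub>v x = U *\<^sub>v (U ^\<^sub>m k *\<^sub>v x)"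
    unfolding pow_mat_Suc_left[OF assms(1)]
    using assms by (intro assoc_mult_mat_vec[of _ n n _ n]) auto
  show "U ^\<^sub>m Suc k *\<^sub>v x = U ^\<^sub>m k *\<^sub>v (U *\<^sub>v x)"
    using assms by (simp add: assoc_mult_mat_vec[of _ n n _ n])
qed

lemma mult_mat_zero_vec:
  assumes "M \<in> carrier_mat n n"
  shows "M *\<^sub>v 0\<^sub>v n = 0\<^sub>v n"
  using assms by (intro eq_vecI) auto

text \<open>
  For the identity \<open>F\<close> these are the kernel vectors of \<open>U\<close> at the bottom of a chain of length at least
  \<open>k + 1\<close>. For an idempotent \<open>F\<close> that commutes with \<open>U\<close> only the chains inside the summand cut out
  by \<open>F\<close> count.
\<close>

definition deep_ker :: "nat \<Rightarrow> 'a::field mat \<Rightarrow> nat \<Rightarrow> 'a mat \<Rightarrow> 'a vec set" where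
  "deep_ker n U k F = {y \<in> carrier_vec n. U *\<^sub>v y = 0\<^sub>v n \<and>
     (\<exists>x\<in>carrier_vec n. y = U ^\<^sub>m k *\<^sub>v (F *\<^sub>v x))}"

lemma vec_subspace_mat_kernel:
  assumes "M \<in> carrier_mat n n"
  shows "vec_subspace n (mat_kernel M)"
  using assms
  by (auto simp: vec_subspace_def mat_kernel_def mult_add_distrib_mat_vec[OF assms] mult_mat_vec[OF assms])

lemma kernel_dim_dim_sub:
  assumes "M \<in> carrier_mat n n"
  shows "kernel_dim M = dim_sub n (mat_kernel M)"
proof -
  interpret kernel n n M by (unfold_locales, rule assms)
  show ?thesis unfolding kernel_dim dim_sub_def ..
qed

lemma vec_subspace_deep_ker:
  assumes U: "U \<in> carrier_mat n n" and F: "F \<in> carrier_mat n n"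
  shows "vec_subspace n (deep_ker n U k F)"
proof -
  have P: "U ^\<^sub>m k \<in> carrier_mat n n" using U by simp
  have "\<exists>z\<in>carrier_vec n. U ^\<^sub>m k *\<^sub>v (F *\<^sub>v x) + U ^\<^sub>m k *\<^sub>v (F *\<^sub>v y) = U ^\<^sub>m k *\<^sub>v (F *\<^sub>v z)"
    if "x \<in> carrier_vec n" "y \<in> carrier_vec n" for x y
    using that F by (intro bexI[of _ "x + y"])
      (auto simp: mult_add_distrib_mat_vec[OF P] mult_add_distrib_mat_vec[OF F])
  moreover have "\<exists>z\<in>carrier_vec n. a \<cdot>\<^sub>v (U ^\<^sub>m k *\<^sub>v (F *\<^sub>v x)) = U ^\<^sub>m k *\<^sub>v (F *\<^sub>v z)"
    if "x \<in> carrier_vec n" for x a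
    using that F by (intro bexI[of _ "a \<cdot>\<^sub>v x"])
      (auto simp: mult_mat_vec[OF P] mult_mat_vec[OF F])
  moreover have "0\<^sub>v n = U ^\<^sub>m k *\<^sub>v (F *\<^sub>v 0\<^sub>v n)"
    by (simp add: mult_mat_zero_vec[OF P] mult_mat_zero_vec[OF F])
  ultimately show ?thesis using U
    by (auto simp: vec_subspace_def deep_ker_def mult_add_distrib_mat_vec[OF U] mult_mat_vec[OF U]
        intro: bexI[of _ "0\<^sub>v n"])
qed

text \<open>
  The power \<open>U\<^sup>k\<close> maps the kernel of \<open>U\<^bsup>k+1\<^esup>\<close> onto the kernel vectors of \<open>U\<close> in the image of
  \<open>U\<^sup>k\<close>, and what it kills is the kernel of \<open>U\<^sup>k\<close>.
\<close>

lemma kernel_dim_pow_Suc: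
  fixes U :: "'a::field mat"
  assumes U: "U \<in> carrier_mat n n"
  shows "kernel_dim (U ^\<^sub>m Suc k) = dim_sub n (deep_ker n U k (1\<^sub>m n)) + kernel_dim (U ^\<^sub>m k)"
proof -
  have P: "U ^\<^sub>m k \<in> carrier_mat n n" and P1: "U ^\<^sub>m Suc k \<in> carrier_mat n n" using U by auto
  let ?W = "mat_kernel (U ^\<^sub>m Suc k)"
  have "(*\<^sub>v) (U ^\<^sub>m k) ` ?W = deep_ker n U k (1\<^sub>m n)"
    using P by (auto simp: mat_kernel[OF P1] deep_ker_def pow_mat_Suc_vec(1)[OF U] simp del: pow_mat.simps)
  moreover have "{x \<in> ?W. U ^\<^sub>m k *\<^sub>v x = 0\<^sub>v n} = mat_kernel (U ^\<^sub>m k)"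
    using U by (auto simp: mat_kernel[OF P] mat_kernel[OF P1] pow_mat_Suc_vec(1)[OF U] simp del: pow_mat.simps)
  ultimately show ?thesis
    using dim_sub_mult_mat[OF P vec_subspace_mat_kernel[OF P1]]
    by (simp add: kernel_dim_dim_sub[OF P] kernel_dim_dim_sub[OF P1] del: pow_mat.simps)
qed

lemma deep_ker_antimono:
  assumes U: "U \<in> carrier_mat n n"
  shows "deep_ker n U (Suc k) (1\<^sub>m n) \<subseteq> deep_ker n U k (1\<^sub>m n)"
  using U by (auto simp: deep_ker_def pow_mat_Suc_vec(2)[OF U] simp del: pow_mat.simps)

lemma nblocks_ge_Suc:
  assumes A: "A \<in> carrier_mat n n"
  shows "nblocks_ge (Suc k) A ev = dim_sub n (deep_ker n (char_matrix (mat_ac A) ev) k (1\<^sub>m n))"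
proof -
  have U: "char_matrix (mat_ac A) ev \<in> carrier_mat n n" using A by simp
  show ?thesis unfolding nblocks_ge_def dim_gen_eigenspace_def
    using kernel_dim_pow_Suc[OF U, of k] by (simp del: pow_mat.simps)
qed

lemma nblocks_ge_antimono:
  assumes A: "A \<in> carrier_mat n n"
  shows "nblocks_ge (Suc (Suc k)) A ev \<le> nblocks_ge (Suc k) A ev"
proof -
  have U: "char_matrix (mat_ac A) ev \<in> carrier_mat n n" using A by simp
  show ?thesis unfolding nblocks_ge_Suc[OF A]
    by (intro dim_sub_mono vec_subspace_deep_ker deep_ker_antimono U one_carrier_mat)
qed

lemma nblocks_eq_conv_ge:
  assumes A: "A \<in> carrier_mat n n" and J: "jordan_nf (mat_ac A) bs"
  shows "nblocks_ge (Suc k) A ev = nblocks_eq (Suc k) A ev + nblocks_ge (Suc (Suc k)) A ev"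
proof -
  let ?U = "char_matrix (mat_ac A) ev"
  have U: "?U \<in> carrier_mat n n" using A by simp
  have eq: "count_list cs x = length (filter ((=) x) cs)"
    for x :: "nat \<times> 'a alg_closure" and cs
    by (induction cs) auto
  have "nblocks_eq (Suc k) A ev = compute_nr_of_jordan_blocks (mat_ac A) ev (Suc k)"
    using nblocks_eq_unique[OF J] compute_nr_of_jordan_blocks[OF J] by (simp add: eq)
  also have "\<dots> = nblocks_ge (Suc k) A ev - nblocks_ge (Suc (Suc k)) A ev"
    unfolding compute_nr_of_jordan_blocks_def nblocks_ge_def
    using kernel_dim_pow_Suc[OF U, of k] kernel_dim_pow_Suc[OF U, of "Suc k"]
    by (simp add: dim_gen_eigenspace_def del: pow_mat.simps)
  finally show ?thesis using nblocks_ge_antimono[OF A, of k ev] by simp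
qed

lemma nblocks_ge_eventually_0:
  assumes J: "jordan_nf (mat_ac A) bs" and k: "k \<ge> sum_list (map fst bs)"
  shows "nblocks_ge (Suc k) A ev = 0"
proof -
  have "min (Suc k) s = min k s" if "(s, e) \<in> set bs" for s e
  proof -
    have "s \<in> set (map fst bs)" using that by force
    hence "s \<le> k" using member_le_sum_list[of s "map fst bs"] k by simp
    thus ?thesis by simp
  qed
  hence "map (min (Suc k)) (map fst [(s, e)\<leftarrow>bs. e = ev]) = map (min k) (map fst [(s, e)\<leftarrow>bs. e = ev])"
    by auto
  from arg_cong[OF this, of sum_list] show ?thesis
    unfolding nblocks_ge_def dim_gen_eigenspace[OF J] by simp
qed

text \<open>
  The number of blocks of size exactly \<open>k\<close> is the drop from \<open>k\<close> to \<open>k + 1\<close> in the number of blocks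
  of size at least \<open>k\<close>. As the latter numbers are eventually zero, they are recovered from the drops
  by descending induction.
\<close>

lemma nblocks_eq_iff_nblocks_ge:
  assumes A: "A \<in> carrier_mat n n" and J: "jordan_nf (mat_ac A) bs"
  shows "(\<forall>k\<ge>1. nblocks_eq k A ev = nblocks_eq k A ev') \<longleftrightarrow>
    (\<forall>k. nblocks_ge (Suc k) A ev = nblocks_ge (Suc k) A ev')"
proof
  assume L: "\<forall>k\<ge>1. nblocks_eq k A ev = nblocks_eq k A ev'"
  let ?K = "sum_list (map fst bs)"
  show "\<forall>k. nblocks_ge (Suc k) A ev = nblocks_ge (Suc k) A ev'"
  proof
    fix k
    show "nblocks_ge (Suc k) A ev = nblocks_ge (Suc k) A ev'"
    proof (induction "?K - k" arbitrary: k)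
      case 0
      thus ?case using nblocks_ge_eventually_0[OF J, of k] by simp
    next
      case (Suc d)
      hence "nblocks_ge (Suc (Suc k)) A ev = nblocks_ge (Suc (Suc k)) A ev'" by simp
      thus ?case using L nblocks_eq_conv_ge[OF A J, of k] by simp
    qed
  qed
next
  assume R: "\<forall>k. nblocks_ge (Suc k) A ev = nblocks_ge (Suc k) A ev'"
  show "\<forall>k\<ge>1. nblocks_eq k A ev = nblocks_eq k A ev'"
  proof (intro allI impI)
    fix k :: nat assume "k \<ge> 1"
    then obtain j where "k = Suc j" by (cases k) auto
    thus "nblocks_eq k A ev = nblocks_eq k A ev'"
      using R nblocks_eq_conv_ge[OF A J, of j ev] nblocks_eq_conv_ge[OF A J, of j ev'] by simp
  qed
qed

section \<open>Square matrices and their polynomials\<close>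

text \<open>
  Fixing the size as a locale parameter makes the dimension side conditions of the matrix laws
  closed terms, so that the simplifier can discharge them.
\<close>

locale square = fixes n :: nat
begin

abbreviation "sq \<equiv> carrier_mat n n"
abbreviation "cv \<equiv> carrier_vec n"

lemma sq_closed [simp, intro]:
  fixes A B :: "'a::field mat"
  shows "A \<in> sq \<Longrightarrow> B \<in> sq \<Longrightarrow> A * B \<in> sq"
    and "A \<in> sq \<Longrightarrow> x \<in> cv \<Longrightarrow> A *\<^sub>v x \<in> cv"
    and "B \<in> sq \<Longrightarrow> A - B \<in> sq"
    and "B \<in> sq \<Longrightarrow> A + B \<in> sq"
  by auto

lemma sq_eqI:
  fixes A B :: "'a::field mat"
  assumes "A \<in> sq" "B \<in> sq" "\<And>i j. i < n \<Longrightarrow> j < n \<Longrightarrow> A $$ (i, j) = B $$ (i, j)"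
  shows "A = B"
  using assms by (intro eq_matI) auto

lemma sq_index:
  fixes A B :: "'a::field mat"
  assumes "i < n" "j < n"
  shows "A \<in> sq \<Longrightarrow> B \<in> sq \<Longrightarrow> (A + B) $$ (i, j) = A $$ (i, j) + B $$ (i, j)"
    and "A \<in> sq \<Longrightarrow> B \<in> sq \<Longrightarrow> (A - B) $$ (i, j) = A $$ (i, j) - B $$ (i, j)"
    and "A \<in> sq \<Longrightarrow> (a \<cdot>\<^sub>m A) $$ (i, j) = a * A $$ (i, j)"
  using assms by auto

lemma sq_diffD:
  fixes A B D :: "'a::field mat"
  assumes "A \<in> sq" "B \<in> sq" "D \<in> sq" "A - B = D"
  shows "A = B + D"
proof (rule sq_eqI)
  fix i j assume ij: "i < n" "j < n"
  have "A $$ (i, j) - B $$ (i, j) = D $$ (i, j)"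
    using sq_index(2)[OF ij assms(1,2)] assms(4) by simp
  thus "A $$ (i, j) = (B + D) $$ (i, j)"
    using sq_index(1)[OF ij assms(2,3)] by (simp add: algebra_simps)
qed (use assms in auto)

lemma sq_simps:
  fixes A B C :: "'a::field mat"
  shows "A \<in> sq \<Longrightarrow> B \<in> sq \<Longrightarrow> C \<in> sq \<Longrightarrow> (A * B) * C = A * (B * C)"
    and "A \<in> sq \<Longrightarrow> B \<in> sq \<Longrightarrow> C \<in> sq \<Longrightarrow> (A + B) * C = A * C + B * C"
    and "A \<in> sq \<Longrightarrow> B \<in> sq \<Longrightarrow> C \<in> sq \<Longrightarrow> A * (B + C) = A * B + A * C"
    and "A \<in> sq \<Longrightarrow> B \<in> sq \<Longrightarrow> C \<in> sq \<Longrightarrow> (A - B) * C = A * C - B * C"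
    and "A \<in> sq \<Longrightarrow> B \<in> sq \<Longrightarrow> C \<in> sq \<Longrightarrow> A * (B - C) = A * B - A * C"
    and "A \<in> sq \<Longrightarrow> B \<in> sq \<Longrightarrow> (a \<cdot>\<^sub>m A) * B = a \<cdot>\<^sub>m (A * B)"
    and "A \<in> sq \<Longrightarrow> B \<in> sq \<Longrightarrow> A * (a \<cdot>\<^sub>m B) = a \<cdot>\<^sub>m (A * B)"
    and "A \<in> sq \<Longrightarrow> 1\<^sub>m n * A = A"
    and "A \<in> sq \<Longrightarrow> A * 1\<^sub>m n = A"
    and "A \<in> sq \<Longrightarrow> 0\<^sub>m n n * A = 0\<^sub>m n n"
    and "A \<in> sq \<Longrightarrow> A * 0\<^sub>m n n = 0\<^sub>m n n"
  by (auto simp: assoc_mult_mat[of _ n n _ n _ n] add_mult_distrib_mat[of _ n n _ _ n]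
      mult_add_distrib_mat[of _ n n _ n] minus_mult_distrib_mat[of _ n n _ _ n]
      mult_minus_distrib_mat[of _ n n _ n])

lemma vec_simps:
  fixes A B :: "'a::field mat"
  shows "A \<in> sq \<Longrightarrow> B \<in> sq \<Longrightarrow> x \<in> cv \<Longrightarrow> (A * B) *\<^sub>v x = A *\<^sub>v (B *\<^sub>v x)"
    and "A \<in> sq \<Longrightarrow> B \<in> sq \<Longrightarrow> x \<in> cv \<Longrightarrow> (A + B) *\<^sub>v x = A *\<^sub>v x + B *\<^sub>v x"
    and "A \<in> sq \<Longrightarrow> B \<in> sq \<Longrightarrow> x \<in> cv \<Longrightarrow> (A - B) *\<^sub>v x = A *\<^sub>v x - B *\<^sub>v x"
    and "A \<in> sq \<Longrightarrow> x \<in> cv \<Longrightarrow> y \<in> cv \<Longrightarrow> A *\<^sub>v (x + y) = A *\<^sub>v x + A *\<^sub>v y"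
    and "A \<in> sq \<Longrightarrow> x \<in> cv \<Longrightarrow> y \<in> cv \<Longrightarrow> A *\<^sub>v (x - y) = A *\<^sub>v x - A *\<^sub>v y"
    and "A \<in> sq \<Longrightarrow> x \<in> cv \<Longrightarrow> (a \<cdot>\<^sub>m A) *\<^sub>v x = a \<cdot>\<^sub>v (A *\<^sub>v x)"
    and "A \<in> sq \<Longrightarrow> x \<in> cv \<Longrightarrow> A *\<^sub>v (a \<cdot>\<^sub>v x) = a \<cdot>\<^sub>v (A *\<^sub>v x)"
    and "x \<in> cv \<Longrightarrow> 0\<^sub>m n n *\<^sub>v x = 0\<^sub>v n"
    and "x \<in> cv \<Longrightarrow> 1\<^sub>m n *\<^sub>v x = x"
    and "A \<in> sq \<Longrightarrow> A *\<^sub>v 0\<^sub>v n = 0\<^sub>v n"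
  by (simp_all add: assoc_mult_mat_vec[of _ n n _ n] add_mult_distrib_mat_vec[of _ n n]
      minus_mult_distrib_mat_vec[of _ n n] mult_add_distrib_mat_vec[of _ n n]
      mult_minus_distrib_mat_vec[of _ n n] mult_mat_vec[of _ n n] mult_mat_zero_vec)
    (auto intro!: eq_vecI)

lemma zero_smult_vec:
  "x \<in> cv \<Longrightarrow> 0 \<cdot>\<^sub>v x = (0\<^sub>v n :: 'a::field vec)"
  "a \<cdot>\<^sub>v 0\<^sub>v n = (0\<^sub>v n :: 'a::field vec)"
  by (auto intro!: eq_vecI)

lemma smult_vec_eq_0D:
  fixes a :: "'a::field"
  assumes "a \<cdot>\<^sub>v x = 0\<^sub>v n" "a \<noteq> 0"
  shows "x = 0\<^sub>v n"
proof -
  have "x = inverse a \<cdot>\<^sub>v (a \<cdot>\<^sub>v x)" using assms(2) by (simp add: smult_smult_assoc)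
  thus ?thesis unfolding assms(1) by (simp only: zero_smult_vec(2))
qed

lemma vec_add_diff: "x \<in> cv \<Longrightarrow> y \<in> cv \<Longrightarrow> x + (y - x) = (y :: 'a::field vec)"
  by (intro eq_vecI) auto

lemma mat_eq_vecI:
  fixes A B :: "'a::field mat"
  assumes A: "A \<in> sq" and B: "B \<in> sq" and eq: "\<And>x. x \<in> cv \<Longrightarrow> A *\<^sub>v x = B *\<^sub>v x"
  shows "A = B"
proof (rule eq_matI)
  fix i j assume "i < dim_row B" "j < dim_col B"
  hence ij: "i < n" "j < n" using B by auto
  from arg_cong[OF eq[of "unit_vec n j"], of "\<lambda>v. vec_index v i"] ij
  show "A $$ (i, j) = B $$ (i, j)" using A B by simp
qed (use A B in auto)

definition poly_mat :: "'a::field mat \<Rightarrow> 'a poly \<Rightarrow> 'a mat" where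
  "poly_mat A p = fold_coeffs (\<lambda>a M. a \<cdot>\<^sub>m 1\<^sub>m n + A * M) p (0\<^sub>m n n)"

text \<open>
  With \<open>p\<^sub>k\<close> the coefficients of \<open>p\<close> this is the sum of all \<open>p\<^bsub>i+j+1\<^esub> Z\<^sup>i u Y\<^sup>j\<close>, a noncommutative
  version of the divided difference \<open>(p(Z) - p(Y)) / (Z - Y)\<close>. A pair is folded because the value
  \<open>p(Z)\<close> of the tail is needed at each step.
\<close>

definition bezoutian :: "'a::field mat \<Rightarrow> 'a mat \<Rightarrow> 'a mat \<Rightarrow> 'a poly \<Rightarrow> 'a mat" where
  "bezoutian Z u Y p = snd (fold_coeffs (\<lambda>a (M, B). (a \<cdot>\<^sub>m 1\<^sub>m n + Z * M, M * u + B * Y)) p (0\<^sub>m n n, 0\<^sub>m n n))"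

lemma poly_mat_0 [simp]: "poly_mat A 0 = 0\<^sub>m n n"
  by (simp add: poly_mat_def)

lemma poly_mat_pCons:
  assumes A: "A \<in> sq"
  shows "poly_mat A (pCons a p) = a \<cdot>\<^sub>m 1\<^sub>m n + A * poly_mat A p"
proof (cases "a = 0 \<and> p = 0")
  case True
  have "0\<^sub>m n n = 0 \<cdot>\<^sub>m 1\<^sub>m n + A * 0\<^sub>m n n" unfolding sq_simps(11)[OF A] by (intro eq_matI) auto
  with True show ?thesis by (simp add: poly_mat_def)
qed (auto simp: poly_mat_def)

lemma poly_mat_closed [simp, intro]: "A \<in> sq \<Longrightarrow> poly_mat A p \<in> sq"
  by (induction p) (auto simp: poly_mat_pCons simp del: assoc_mult_mat assoc_add_mat)

lemma fold_bezoutian: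
  assumes Z: "Z \<in> sq"
  shows "fold_coeffs (\<lambda>a (M, B). (a \<cdot>\<^sub>m 1\<^sub>m n + Z * M, M * u + B * Y)) p (0\<^sub>m n n, 0\<^sub>m n n)
    = (poly_mat Z p, bezoutian Z u Y p)"
proof -
  let ?f = "\<lambda>a (M, B). (a \<cdot>\<^sub>m 1\<^sub>m n + Z * M, M * u + B * Y)"
  have "fst (fold_coeffs ?f p (0\<^sub>m n n, 0\<^sub>m n n)) = poly_mat Z p"
  proof (induction p)
    case (pCons a p)
    thus ?case by (auto simp: poly_mat_pCons[OF Z] split: prod.splits)
  qed simp
  thus ?thesis by (auto simp: bezoutian_def prod_eq_iff)
qed

lemma bezoutian_0 [simp]: "bezoutian Z u Y 0 = 0\<^sub>m n n"
  by (simp add: bezoutian_def)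

lemma bezoutian_pCons:
  assumes "Z \<in> sq" "u \<in> sq" "Y \<in> sq"
  shows "bezoutian Z u Y (pCons a p) = poly_mat Z p * u + bezoutian Z u Y p * Y"
proof (cases "a = 0 \<and> p = 0")
  case True
  have "0\<^sub>m n n = 0\<^sub>m n n * u + 0\<^sub>m n n * Y"
    unfolding sq_simps(10)[OF assms(2)] sq_simps(10)[OF assms(3)] by (intro eq_matI) auto
  with True show ?thesis by (simp add: bezoutian_def)
next
  case False
  let ?f = "\<lambda>a (M, B). (a \<cdot>\<^sub>m 1\<^sub>m n + Z * M, M * u + B * Y)"
  have "fold_coeffs ?f (pCons a p) (0\<^sub>m n n, 0\<^sub>m n n)
    = ?f a (fold_coeffs ?f p (0\<^sub>m n n, 0\<^sub>m n n))"
    using False by auto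
  also have "\<dots> = ?f a (poly_mat Z p, bezoutian Z u Y p)" unfolding fold_bezoutian[OF assms(1)] ..
  finally have "fold_coeffs ?f (pCons a p) (0\<^sub>m n n, 0\<^sub>m n n) = ?f a (poly_mat Z p, bezoutian Z u Y p)" .
  thus ?thesis by (simp add: bezoutian_def[of Z u Y "pCons a p"])
qed

lemma bezoutian_closed [simp, intro]: "Z \<in> sq \<Longrightarrow> u \<in> sq \<Longrightarrow> Y \<in> sq \<Longrightarrow> bezoutian Z u Y p \<in> sq"
  by (induction p) (auto simp: bezoutian_pCons)

text \<open>
  Used with \<open>Z = Y\<close> for matrices that commute with \<open>Y\<close>, and with \<open>Z = c - Y\<close> for skew roots.
\<close>

lemma poly_mat_intertwine:
  assumes [simp]: "Z \<in> sq" "Y \<in> sq" "S \<in> sq" and XS: "Z * S = S * Y"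
  shows "poly_mat Z p * S = S * poly_mat Y p"
proof (induction p)
  case (pCons a p)
  have "Z * (poly_mat Z p * S) = (Z * S) * poly_mat Y p"
    unfolding pCons by (rule sq_simps(1)[symmetric]) auto
  also have "\<dots> = S * (Y * poly_mat Y p)"
    unfolding XS by (rule sq_simps(1)) auto
  finally have "Z * (poly_mat Z p * S) = S * (Y * poly_mat Y p)" .
  thus ?case by (simp add: poly_mat_pCons sq_simps)
qed (simp add: sq_simps)

lemma poly_mat_commute:
  assumes "A \<in> sq" "S \<in> sq" "A * S = S * A"
  shows "poly_mat A p * S = S * poly_mat A p"
  using poly_mat_intertwine assms by blast

lemma poly_mat_add: "A \<in> sq \<Longrightarrow> poly_mat A (p + q) = poly_mat A p + poly_mat A q"
proof (induction p q rule: poly_induct2)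
  case (pCons a p b q)
  have "poly_mat A (pCons a p + pCons b q) = (a + b) \<cdot>\<^sub>m 1\<^sub>m n + A * (poly_mat A p + poly_mat A q)"
    using pCons by (simp add: poly_mat_pCons)
  also have "\<dots> = poly_mat A (pCons a p) + poly_mat A (pCons b q)" using pCons.prems
    by (simp add: poly_mat_pCons sq_simps) (rule sq_eqI; simp add: sq_index algebra_simps del: index_mult_mat(1) index_one_mat)
  finally show ?case .
qed auto

lemma poly_mat_diff:
  assumes "A \<in> sq"
  shows "poly_mat A (p - q) = poly_mat A p - poly_mat A q"
proof -
  have "poly_mat A p = poly_mat A (p - q) + poly_mat A q" using poly_mat_add[OF assms, of "p - q" q] by simp
  thus ?thesis using assms by (auto intro!: sq_eqI simp: sq_index simp del: index_mult_mat(1))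
qed

lemma poly_mat_smult: "A \<in> sq \<Longrightarrow> poly_mat A (smult a p) = a \<cdot>\<^sub>m poly_mat A p"
proof (induction p)
  case (pCons b p)
  thus ?case
    by (simp add: poly_mat_pCons sq_simps) (rule sq_eqI; simp add: sq_index algebra_simps del: index_mult_mat(1) index_one_mat)
qed auto

lemma poly_mat_mult: "A \<in> sq \<Longrightarrow> poly_mat A (p * q) = poly_mat A p * poly_mat A q"
proof (induction p)
  case (pCons a p)
  have "poly_mat A (pCons a p * q) = a \<cdot>\<^sub>m poly_mat A q + (0 \<cdot>\<^sub>m 1\<^sub>m n + A * (poly_mat A p * poly_mat A q))"
    using pCons by (simp add: poly_mat_add poly_mat_smult poly_mat_pCons)
  also have "0 \<cdot>\<^sub>m 1\<^sub>m n + A * (poly_mat A p * poly_mat A q) = A * (poly_mat A p * poly_mat A q)"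
    using pCons.prems by (intro sq_eqI) (auto simp: sq_index simp del: index_mult_mat(1))
  finally show ?case using pCons.prems by (simp add: poly_mat_pCons sq_simps)
qed (simp add: sq_simps)

lemma poly_mat_const: "A \<in> sq \<Longrightarrow> poly_mat A [:a:] = a \<cdot>\<^sub>m 1\<^sub>m n"
  by (simp add: poly_mat_pCons sq_simps)

lemma poly_mat_1 [simp]: "A \<in> sq \<Longrightarrow> poly_mat A 1 = 1\<^sub>m n"
  unfolding one_pCons by (subst poly_mat_const) (auto intro: eq_matI)

lemma poly_mat_linear: "A \<in> sq \<Longrightarrow> poly_mat A [:a, b:] = a \<cdot>\<^sub>m 1\<^sub>m n + b \<cdot>\<^sub>m A"
  by (simp add: poly_mat_pCons[of A a] poly_mat_const sq_simps)

lemma poly_mat_X: "A \<in> sq \<Longrightarrow> poly_mat A [:0, 1:] = A"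
  by (subst poly_mat_linear) (auto intro!: eq_matI)

lemma poly_mat_power: "A \<in> sq \<Longrightarrow> poly_mat A (p ^ k) = poly_mat A p ^\<^sub>m k"
proof (induction k)
  case 0
  hence "dim_row (poly_mat A p) = n" using poly_mat_closed[of A p] by blast
  with 0 show ?case by simp
qed (simp add: poly_mat_mult pow_mat_Suc_left[OF poly_mat_closed] del: pow_mat.simps(2))

lemma poly_mat_pcompose:
  assumes [simp]: "A \<in> sq"
  shows "poly_mat A (p \<circ>\<^sub>p q) = poly_mat (poly_mat A q) p"
  by (induction p) (simp_all add: pcompose_pCons poly_mat_add poly_mat_mult poly_mat_const poly_mat_pCons[of "poly_mat A q"])

lemma poly_mat_commutes: "A \<in> sq \<Longrightarrow> poly_mat A p * poly_mat A q = poly_mat A q * poly_mat A p"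
  by (simp flip: poly_mat_mult add: mult.commute)

text \<open>
  The noncommutative form of \<open>(Z - Y) \<cdot> (p(Z) - p(Y)) / (Z - Y) = p(Z) - p(Y)\<close>.
\<close>

lemma bezoutian_telescope:
  assumes [simp]: "Z \<in> sq" "u \<in> sq" "Y \<in> sq"
  shows "Z * bezoutian Z u Y p - bezoutian Z u Y p * Y = poly_mat Z p * u - u * poly_mat Y p"
proof (induction p)
  case 0 thus ?case by (simp add: sq_simps)
next
  case (pCons a p)
  let ?B = "bezoutian Z u Y p" and ?P = "poly_mat Z p" and ?Q = "poly_mat Y p"
  have ZP: "?P * Z = Z * ?P" by (rule poly_mat_commute) auto
  have YP: "?Q * Y = Y * ?Q" by (rule poly_mat_commute) auto
  have "Z * (?B * Y) - ?B * (Y * Y) = (Z * ?B - ?B * Y) * Y" by (simp add: sq_simps)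
  also have "\<dots> = ?P * (u * Y) - u * (Y * ?Q)"
    unfolding pCons by (simp add: sq_simps YP)
  finally have *: "Z * (?B * Y) - ?B * (Y * Y) = ?P * (u * Y) - u * (Y * ?Q)" .
  have "Z * bezoutian Z u Y (pCons a p) - bezoutian Z u Y (pCons a p) * Y
    = (Z * (?P * u) - ?P * (u * Y)) + (Z * (?B * Y) - ?B * (Y * Y))"
    by (simp add: bezoutian_pCons sq_simps) (rule sq_eqI; simp add: sq_index algebra_simps del: index_mult_mat(1) index_one_mat)
  also have "\<dots> = poly_mat Z (pCons a p) * u - u * poly_mat Y (pCons a p)"
    unfolding * by (simp add: poly_mat_pCons sq_simps)
      (rule sq_eqI; simp add: sq_index algebra_simps del: index_mult_mat(1) index_one_mat)
  finally show ?case .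
qed

lemma vec_subspace_image:
  assumes M: "M \<in> sq" and W: "vec_subspace n W"
  shows "vec_subspace n ((*\<^sub>v) M ` W)"
  unfolding vec_subspace_def
proof (intro conjI allI ballI)
  have Wcv: "x \<in> W \<Longrightarrow> x \<in> cv" for x using W by (auto simp: vec_subspace_def)
  show "(*\<^sub>v) M ` W \<subseteq> cv" using M Wcv by auto
  have "0\<^sub>v n = M *\<^sub>v 0\<^sub>v n" using M by (simp add: vec_simps)
  thus "0\<^sub>v n \<in> (*\<^sub>v) M ` W" using W unfolding vec_subspace_def by blast
  show "x + y \<in> (*\<^sub>v) M ` W" if "x \<in> (*\<^sub>v) M ` W" "y \<in> (*\<^sub>v) M ` W" for x y
  proof -
    from that obtain x' y' where "x' \<in> W" "y' \<in> W" "x = M *\<^sub>v x'" "y = M *\<^sub>v y'" by blast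
    moreover from this have "x + y = M *\<^sub>v (x' + y')" using M Wcv by (simp add: vec_simps)
    ultimately show ?thesis using W unfolding vec_subspace_def by blast
  qed
  show "a \<cdot>\<^sub>v x \<in> (*\<^sub>v) M ` W" if "x \<in> (*\<^sub>v) M ` W" for a x
  proof -
    from that obtain x' where "x' \<in> W" "x = M *\<^sub>v x'" by blast
    moreover from this have "a \<cdot>\<^sub>v x = M *\<^sub>v (a \<cdot>\<^sub>v x')" using M Wcv by (simp add: vec_simps)
    ultimately show ?thesis using W unfolding vec_subspace_def by blast
  qed
qed

lemma vec_subspace_range:
  assumes x: "x \<in> cv"
  shows "vec_subspace n (range (\<lambda>a. a \<cdot>\<^sub>v (x :: 'a::field vec)))"
  unfolding vec_subspace_def
proof (intro conjI allI ballI)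
  show "range (\<lambda>a. a \<cdot>\<^sub>v x) \<subseteq> cv" using x by auto
  show "0\<^sub>v n \<in> range (\<lambda>a. a \<cdot>\<^sub>v x)"
    using zero_smult_vec(1)[OF x] by (metis rangeI)
  show "y + z \<in> range (\<lambda>a. a \<cdot>\<^sub>v x)" if "y \<in> range (\<lambda>a. a \<cdot>\<^sub>v x)" "z \<in> range (\<lambda>a. a \<cdot>\<^sub>v x)" for y z
    using that by (auto simp: add_smult_distrib_vec[symmetric])
  show "a \<cdot>\<^sub>v y \<in> range (\<lambda>a. a \<cdot>\<^sub>v x)" if "y \<in> range (\<lambda>a. a \<cdot>\<^sub>v x)" for a y
    using that by (auto simp: smult_smult_assoc)
qed

lemma vec_subspace_ker:
  assumes M: "M \<in> sq" and W: "vec_subspace n W"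
  shows "vec_subspace n {x \<in> W. M *\<^sub>v x = 0\<^sub>v n}"
proof -
  have Wcv: "x \<in> W \<Longrightarrow> x \<in> cv" for x using W by (auto simp: vec_subspace_def)
  show ?thesis using W M Wcv unfolding vec_subspace_def
    by (auto simp: vec_simps zero_smult_vec)
qed

definition outer :: "'a::field vec \<Rightarrow> 'a vec \<Rightarrow> 'a mat" where
  "outer v w = mat n n (\<lambda>(i, j). vec_index v i * vec_index w j)"

lemma outer_closed [simp, intro]: "outer v w \<in> sq"
  by (simp add: outer_def)

lemma outer_mult_vec:
  assumes "v \<in> cv" "w \<in> cv" "x \<in> cv"
  shows "outer v w *\<^sub>v x = (w \<bullet> x) \<cdot>\<^sub>v v"
  using assms
  by (intro eq_vecI)
    (auto simp: outer_def scalar_prod_def sum_distrib_right sum_distrib_left intro!: sum.cong)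

end

section \<open>Cyclic direct summands\<close>

text \<open>
  The powers \<open>A\<^sup>i v\<close> and the functionals \<open>w A\<^sup>j\<close> with \<open>i, j < degree d\<close> have an antitriangular matrix
  of pairings. So the whole space is the direct sum of the cyclic submodule generated by \<open>v\<close> and the
  common kernel of the functionals \<open>w A\<^sup>j\<close>. The matrix equation \<open>w_d\<close> says that \<open>d\<close> annihilates the functional \<open>w\<close>; in this
  form it can be transported along field extensions.
\<close>

locale cyclic_pair = square +
  fixes A :: "'a::field mat" and v w :: "'a vec" and d :: "'a poly"
  assumes A [simp]: "A \<in> sq" and v [simp]: "v \<in> cv" and w [simp]: "w \<in> cv"
    and monic: "lead_coeff d = 1" and deg: "degree d > 0"
    and d_v: "poly_mat A d *\<^sub>v v = 0\<^sub>v n" and w_d: "outer v w * poly_mat A d = 0\<^sub>m n n"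
    and dual: "\<And>i. i < degree d \<Longrightarrow> w \<bullet> (A ^\<^sub>m i *\<^sub>v v) = (if Suc i = degree d then 1 else 0)"
begin

abbreviation "u \<equiv> outer v w"

definition "proj = bezoutian A u A d"

lemma d_u: "poly_mat A d * u = 0\<^sub>m n n"
  by (rule mat_eq_vecI) (auto simp: vec_simps outer_mult_vec d_v)

lemma proj_closed [simp, intro]: "proj \<in> sq"
  by (simp add: proj_def bezoutian_closed)

text \<open>
  By the telescoping identity the commutator is \<open>d(A) u - u d(A)\<close>, and both terms vanish because \<open>d\<close>
  annihilates \<open>v\<close> and \<open>w\<close>.
\<close>

lemma proj_commute: "A * proj = proj * A"
proof -
  have "A * proj - proj * A = 0\<^sub>m n n"
    unfolding proj_def by (subst bezoutian_telescope) (auto simp: d_u w_d intro!: eq_matI)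
  hence "A * proj = proj * A + 0\<^sub>m n n" by (intro sq_diffD) auto
  thus ?thesis by simp
qed

lemma bezoutian_range:
  assumes Z: "Z \<in> sq" and x: "x \<in> cv"
  shows "\<exists>f. bezoutian Z u A p *\<^sub>v x = poly_mat Z f *\<^sub>v v"
  using x
proof (induction p arbitrary: x)
  case 0
  thus ?case by (intro exI[of _ 0]) (simp add: vec_simps)
next
  case (pCons a p)
  from pCons.IH[of "A *\<^sub>v x"] pCons.prems obtain f
    where f: "bezoutian Z u A p *\<^sub>v (A *\<^sub>v x) = poly_mat Z f *\<^sub>v v" by auto
  have "bezoutian Z u A (pCons a p) *\<^sub>v x = poly_mat Z (smult (w \<bullet> x) p + f) *\<^sub>v v"
    using pCons.prems Z by (simp add: bezoutian_pCons vec_simps outer_mult_vec f poly_mat_add poly_mat_smult)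
  thus ?case by blast
qed

text \<open>
  Of the terms \<open>p\<^bsub>i'+j+1\<^esub> Z\<^bsup>i'\<^esup> v w A\<^bsup>j+i\<^esup> v\<close> the degree bound leaves only those with
  \<open>j + i \<le> degree d - 1\<close>, and among these the pairing is nonzero for \<open>j + i = degree d - 1\<close> only. The
  general index \<open>i\<close> is there for the induction; the case of interest is \<open>bezoutian_d_v\<close>.
\<close>

lemma bezoutian_power:
  assumes Z: "Z \<in> sq" and "i < degree d" "degree p + i \<le> degree d"
  shows "bezoutian Z u A p *\<^sub>v (A ^\<^sub>m i *\<^sub>v v) = coeff p (degree d - i) \<cdot>\<^sub>v v"
  using assms(2,3)
proof (induction p arbitrary: i)
  case 0
  thus ?case by (simp add: vec_simps zero_smult_vec)
next
  case (pCons a p)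
  let ?x = "A ^\<^sub>m i *\<^sub>v v"
  have x: "?x \<in> cv" by simp
  have step: "bezoutian Z u A (pCons a p) *\<^sub>v ?x
    = (w \<bullet> ?x) \<cdot>\<^sub>v (poly_mat Z p *\<^sub>v v) + bezoutian Z u A p *\<^sub>v (A ^\<^sub>m Suc i *\<^sub>v v)"
    using Z x by (simp add: bezoutian_pCons vec_simps outer_mult_vec pow_mat_Suc_vec(1)[OF A v] del: pow_mat.simps)
  show ?case
  proof (cases "p = 0")
    case True
    have "coeff [:a:] (degree d - i) = 0" using pCons.prems by (cases "degree d - i") auto
    with True show ?thesis using x pCons.prems
      by (simp add: step[unfolded True] vec_simps zero_smult_vec)
  next
    case p: False
    hence deg_p: "degree p + Suc i \<le> degree d" using pCons.prems by simp
    have sub: "degree d - i = Suc (degree d - Suc i)" using pCons.prems by simp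
    show ?thesis
    proof (cases "Suc i < degree d")
      case True
      have "bezoutian Z u A p *\<^sub>v (A ^\<^sub>m Suc i *\<^sub>v v) = coeff p (degree d - Suc i) \<cdot>\<^sub>v v"
        by (rule pCons.IH[OF True deg_p])
      moreover have "w \<bullet> ?x = 0" using dual[of i] True by simp
      moreover have "0 \<cdot>\<^sub>v (poly_mat Z p *\<^sub>v v) = 0\<^sub>v n" using Z by (simp add: zero_smult_vec)
      ultimately show ?thesis using step sub by simp
    next
      case False
      hence i: "Suc i = degree d" using pCons.prems by simp
      with deg_p have "degree p = 0" by simp
      then obtain c where c: "p = [:c:]" by (elim degree_eq_zeroE)
      have bz0: "bezoutian Z u A p *\<^sub>v (A ^\<^sub>m Suc i *\<^sub>v v) = 0\<^sub>v n"
        using Z unfolding c by (simp add: bezoutian_pCons vec_simps sq_simps del: pow_mat.simps)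
      have "w \<bullet> ?x = 1" using dual[of i] i by simp
      with step bz0 Z show ?thesis unfolding sub unfolding c i
        by (simp add: poly_mat_const vec_simps)
    qed
  qed
qed

lemma bezoutian_d_v:
  assumes "Z \<in> sq"
  shows "bezoutian Z u A d *\<^sub>v v = v"
  using bezoutian_power[OF assms deg, of d] monic by (simp add: vec_simps carrier_matD[OF A])

text \<open>
  The projection fixes \<open>v\<close> and commutes with \<open>A\<close>, so it fixes the submodule generated by \<open>v\<close>.
\<close>

lemma proj_poly_mat:
  shows "proj *\<^sub>v (poly_mat A f *\<^sub>v v) = poly_mat A f *\<^sub>v v"
proof -
  have "poly_mat A f * proj = proj * poly_mat A f" by (rule poly_mat_commute) (auto simp: proj_commute)
  hence "proj *\<^sub>v (poly_mat A f *\<^sub>v v) = poly_mat A f *\<^sub>v (proj *\<^sub>v v)"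
    by (metis A poly_mat_closed proj_closed v vec_simps(1))
  thus ?thesis by (simp add: proj_def bezoutian_d_v)
qed

lemma proj_range: "x \<in> cv \<Longrightarrow> \<exists>f. proj *\<^sub>v x = poly_mat A f *\<^sub>v v"
  unfolding proj_def by (rule bezoutian_range) auto

lemma proj_idem: "proj * proj = proj"
proof (rule mat_eq_vecI)
  fix x :: "'a vec" assume x: "x \<in> cv"
  with proj_range obtain f where f: "proj *\<^sub>v x = poly_mat A f *\<^sub>v v" by blast
  have "proj * proj *\<^sub>v x = proj *\<^sub>v (proj *\<^sub>v x)" using x by (simp add: vec_simps)
  thus "proj * proj *\<^sub>v x = proj *\<^sub>v x" unfolding f by (simp add: proj_poly_mat)
qed auto

lemma d_poly_mat_v: "poly_mat A d *\<^sub>v (poly_mat A f *\<^sub>v v) = 0\<^sub>v n"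
proof -
  have "poly_mat A d *\<^sub>v (poly_mat A f *\<^sub>v v) = poly_mat A f *\<^sub>v (poly_mat A d *\<^sub>v v)"
    using poly_mat_commutes[OF A, of d f] by (metis A poly_mat_closed v vec_simps(1))
  thus ?thesis by (simp add: d_v vec_simps)
qed

lemma d_proj: "poly_mat A d * proj = 0\<^sub>m n n"
proof (rule mat_eq_vecI)
  fix x :: "'a vec" assume x: "x \<in> cv"
  with proj_range obtain f where f: "proj *\<^sub>v x = poly_mat A f *\<^sub>v v" by blast
  show "poly_mat A d * proj *\<^sub>v x = 0\<^sub>m n n *\<^sub>v x" using x by (simp add: vec_simps f d_poly_mat_v)
qed auto

text \<open>
  Applying \<open>w A\<^sup>j\<close> to \<open>p(A) v\<close> with the right \<open>j\<close> reads off the leading coefficient of \<open>p\<close>. This shows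
  that no polynomial of degree below that of \<open>d\<close> annihilates \<open>v\<close>.
\<close>

lemma dual_poly_mat:
  assumes "degree p + j < degree d"
  shows "w \<bullet> (A ^\<^sub>m j *\<^sub>v (poly_mat A p *\<^sub>v v)) = coeff p (degree d - Suc j)"
  using assms
proof (induction p arbitrary: j)
  case 0
  thus ?case by (simp add: vec_simps)
next
  case (pCons a p)
  have eq: "A ^\<^sub>m j *\<^sub>v (poly_mat A (pCons a p) *\<^sub>v v)
    = a \<cdot>\<^sub>v (A ^\<^sub>m j *\<^sub>v v) + A ^\<^sub>m Suc j *\<^sub>v (poly_mat A p *\<^sub>v v)"
    by (simp add: poly_mat_pCons vec_simps)
  have "w \<bullet> (A ^\<^sub>m j *\<^sub>v (poly_mat A (pCons a p) *\<^sub>v v))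
    = a * (w \<bullet> (A ^\<^sub>m j *\<^sub>v v)) + w \<bullet> (A ^\<^sub>m Suc j *\<^sub>v (poly_mat A p *\<^sub>v v))"
    unfolding eq by (subst scalar_prod_add_distrib[of _ n]) (auto simp: scalar_prod_smult_distrib[of _ n])
  also have "\<dots> = coeff (pCons a p) (degree d - Suc j)"
  proof (cases "p = 0")
    case True
    have "coeff [:a:] (degree d - Suc j) = (if Suc j = degree d then a else 0)"
      using pCons.prems by (cases "degree d - Suc j") auto
    with True show ?thesis using dual[of j] pCons.prems
      by (simp add: vec_simps del: pow_mat.simps)
  next
    case False
    hence "degree p + Suc j < degree d" using pCons.prems by simp
    moreover from this have "degree d - Suc j = Suc (degree d - Suc (Suc j))" by simp
    ultimately show ?thesis using dual[of j] pCons.IH[of "Suc j"] by simp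
  qed
  finally show ?case .
qed

text \<open>
  In other words, the submodule generated by \<open>v\<close> is a copy of \<open>K[t]/(d)\<close>.
\<close>

lemma poly_mat_v_eq_0_iff: "poly_mat A f *\<^sub>v v = 0\<^sub>v n \<longleftrightarrow> d dvd f"
proof
  assume f0: "poly_mat A f *\<^sub>v v = 0\<^sub>v n"
  let ?r = "f mod d"
  have "poly_mat A f = poly_mat A (f div d * d + ?r)" by simp
  also have "\<dots> = poly_mat A (f div d) * poly_mat A d + poly_mat A ?r" by (simp only: poly_mat_add poly_mat_mult A)
  finally have r0: "poly_mat A ?r *\<^sub>v v = 0\<^sub>v n" using f0 by (simp add: vec_simps d_v)
  have d0: "d \<noteq> 0" using deg by auto
  have "?r = 0"
  proof (rule ccontr)
    assume r: "?r \<noteq> 0"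
    hence lt: "degree ?r < degree d" using degree_mod_less[OF d0, of f] by simp
    let ?j = "degree d - Suc (degree ?r)"
    have "coeff ?r (degree d - Suc ?j) = 0"
      using dual_poly_mat[of ?r ?j] lt by (simp add: r0 vec_simps)
    moreover have "degree d - Suc ?j = degree ?r" using lt by simp
    ultimately show False using r by simp
  qed
  thus "d dvd f" by (simp add: mod_eq_0_iff_dvd)
next
  assume "d dvd f"
  then obtain g where "f = g * d" by (metis dvdE mult.commute)
  thus "poly_mat A f *\<^sub>v v = 0\<^sub>v n" by (simp add: poly_mat_mult vec_simps d_v)
qed

end

section \<open>Eigenvectors and direct summands\<close>

context square
begin

lemma poly_mat_vec_mult: "A \<in> sq \<Longrightarrow> x \<in> cv \<Longrightarrow> poly_mat A p *\<^sub>v (poly_mat A q *\<^sub>v x) = poly_mat A (p * q) *\<^sub>v x"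
  by (simp add: poly_mat_mult vec_simps)

lemma char_matrix_poly_mat: "A \<in> sq \<Longrightarrow> char_matrix A e = poly_mat A [:-e, 1:]"
  by (simp add: char_matrix_def poly_mat_linear) (rule sq_eqI; simp add: sq_index algebra_simps del: index_one_mat)

lemma poly_mat_eigen:
  assumes A: "A \<in> sq" and y: "y \<in> cv" and eig: "char_matrix A e *\<^sub>v y = 0\<^sub>v n"
  shows "poly_mat A q *\<^sub>v y = poly q e \<cdot>\<^sub>v y"
proof -
  obtain r where "q - [:poly q e:] = [:-e, 1:] * r"
    by (metis dvd_def poly_eq_0_iff_dvd poly_diff poly_pCons poly_0 mult_zero_right add_0_right diff_self)
  hence "q = r * [:-e, 1:] + [:poly q e:]" by (simp add: algebra_simps)
  hence "poly_mat A q = poly_mat A r * char_matrix A e + poly q e \<cdot>\<^sub>m 1\<^sub>m n"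
    using A by (metis poly_mat_add poly_mat_mult poly_mat_const char_matrix_poly_mat)
  thus ?thesis using A y eig by (simp add: vec_simps)
qed

text \<open>
  Let \<open>d = (t - e)\<^sup>s q\<close> with \<open>q(e) \<noteq> 0\<close>. A vector \<open>y = (A - e)\<^sup>k F x\<close> with \<open>k \<ge> s\<close> is annihilated by
  \<open>q(A)\<close>, since \<open>d\<close> annihilates the image of \<open>F\<close>. If \<open>y\<close> is also an eigenvector for \<open>e\<close>, then
  \<open>q(A) y = q(e) y\<close>, so that \<open>y = 0\<close>.
\<close>

lemma deep_ker_beyond_order:
  assumes A: "A \<in> sq" and F: "F \<in> sq" and d0: "d \<noteq> 0" and dF: "poly_mat A d * F = 0\<^sub>m n n"
    and k: "order e d \<le> k"
  shows "deep_ker n (char_matrix A e) k F = {0\<^sub>v n}"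
proof -
  let ?U = "char_matrix A e"
  have U: "?U \<in> sq" using A by simp
  obtain q where q: "d = [:-e, 1:] ^ order e d * q" "\<not> [:-e, 1:] dvd q"
    using order_decomp[OF d0, of e] by blast
  have qe: "poly q e \<noteq> 0" using q(2) by (simp add: poly_eq_0_iff_dvd)
  have "y = 0\<^sub>v n" if "y \<in> deep_ker n ?U k F" for y
  proof -
    from that obtain x where y: "y \<in> cv" "?U *\<^sub>v y = 0\<^sub>v n" and x: "x \<in> cv"
      and yx: "y = ?U ^\<^sub>m k *\<^sub>v (F *\<^sub>v x)" by (auto simp: deep_ker_def)
    have Uk: "?U ^\<^sub>m k = poly_mat A ([:-e, 1:] ^ k)" using A by (simp add: poly_mat_power char_matrix_poly_mat)
    have eq: "q * [:-e, 1:] ^ k = [:-e, 1:] ^ (k - order e d) * d"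
    proof -
      have "[:-e, 1:] ^ k = [:-e, 1:] ^ (k - order e d) * [:-e, 1:] ^ order e d"
        using k by (simp flip: power_add)
      thus ?thesis by (subst (2) q(1)) (simp only: ac_simps)
    qed
    have "poly_mat A d *\<^sub>v (F *\<^sub>v x) = 0\<^sub>v n"
      using arg_cong[OF dF, of "\<lambda>M. M *\<^sub>v x"] A F x by (simp add: vec_simps)
    hence "poly_mat A q *\<^sub>v y = 0\<^sub>v n"
      unfolding yx Uk using A F x
      by (simp add: poly_mat_vec_mult eq) (simp add: poly_mat_mult vec_simps)
    hence "poly q e \<cdot>\<^sub>v y = 0\<^sub>v n" using poly_mat_eigen[OF A y] by simp
    thus ?thesis using qe by (rule smult_vec_eq_0D)
  qed
  moreover have "0\<^sub>v n \<in> deep_ker n ?U k F"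
    using vec_subspace_deep_ker[OF U F, of k] by (simp add: vec_subspace_def)
  ultimately show ?thesis by blast
qed

lemma pow_commute:
  fixes U E :: "'a::field mat"
  assumes "U \<in> sq" "E \<in> sq" "U * E = E * U"
  shows "U ^\<^sub>m k * E = E * U ^\<^sub>m k"
proof -
  have "poly_mat U ([:0, 1:] ^ k) * E = E * poly_mat U ([:0, 1:] ^ k)" by (rule poly_mat_commute) (fact assms)+
  thus ?thesis using assms by (simp add: poly_mat_power poly_mat_X)
qed

lemma pow_commute_vec:
  fixes U E :: "'a::field mat"
  assumes "U \<in> sq" "E \<in> sq" "U * E = E * U" "x \<in> cv"
  shows "E *\<^sub>v (U ^\<^sub>m k *\<^sub>v x) = U ^\<^sub>m k *\<^sub>v (E *\<^sub>v x)"
  using pow_commute[OF assms(1-3), of k] assms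
  by (metis pow_carrier_mat vec_simps(1))

text \<open>
  Rank-nullity for \<open>E\<close> on the space of \<open>F\<close>: the image is the space of \<open>E\<close> and the kernel is that of
  \<open>F - E\<close>. This is the additivity of block numbers over a direct sum.
\<close>

lemma dim_sub_deep_ker_split:
  fixes U E F :: "'a::field mat"
  assumes U: "U \<in> sq" and F: "F \<in> sq" and E: "E \<in> sq"
    and UF: "U * F = F * U" and UE: "U * E = E * U"
    and FF: "F * F = F" and EE: "E * E = E" and EF: "E * F = E" and FE: "F * E = E"
  shows "dim_sub n (deep_ker n U k F) = dim_sub n (deep_ker n U k E) + dim_sub n (deep_ker n U k (F - E))"
proof -
  let ?W = "deep_ker n U k F"
  have P: "U ^\<^sub>m k \<in> sq" using U by simp
  have EEv: "E *\<^sub>v (E *\<^sub>v x) = E *\<^sub>v x" "E *\<^sub>v (F *\<^sub>v x) = E *\<^sub>v x"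
    "F *\<^sub>v (E *\<^sub>v x) = E *\<^sub>v x" "F *\<^sub>v (F *\<^sub>v x) = F *\<^sub>v x" if "x \<in> cv" for x
    using that E F EE EF FE FF by (metis vec_simps(1))+
  note com = pow_commute_vec[OF U E UE] pow_commute_vec[OF U F UF]
  have UEv: "U *\<^sub>v (E *\<^sub>v x) = E *\<^sub>v (U *\<^sub>v x)" if "x \<in> cv" for x
    using that E U UE by (metis vec_simps(1))
  have 1: "(*\<^sub>v) E ` ?W = deep_ker n U k E"
  proof safe
    fix y assume "y \<in> ?W"
    then obtain x where x: "x \<in> cv" "y \<in> cv" "U *\<^sub>v y = 0\<^sub>v n" "y = U ^\<^sub>m k *\<^sub>v (F *\<^sub>v x)"
      by (auto simp: deep_ker_def)
    have "E *\<^sub>v y = U ^\<^sub>m k *\<^sub>v (E *\<^sub>v x)" using x F P by (simp add: com EEv)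
    moreover have "U *\<^sub>v (E *\<^sub>v y) = 0\<^sub>v n" using x E by (simp add: UEv vec_simps)
    ultimately show "E *\<^sub>v y \<in> deep_ker n U k E"
      using x(1,2) sq_closed(2)[OF E x(2)] unfolding deep_ker_def by blast
  next
    fix y assume "y \<in> deep_ker n U k E"
    then obtain x where x: "x \<in> cv" "y \<in> cv" "U *\<^sub>v y = 0\<^sub>v n" "y = U ^\<^sub>m k *\<^sub>v (E *\<^sub>v x)"
      by (auto simp: deep_ker_def)
    have "y = E *\<^sub>v y" using x E by (simp add: com EEv)
    moreover have "y = U ^\<^sub>m k *\<^sub>v (F *\<^sub>v (E *\<^sub>v x))" using x E by (simp add: EEv)
    hence "y \<in> ?W" using x E unfolding deep_ker_def by blast
    ultimately show "y \<in> (*\<^sub>v) E ` ?W" by blast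
  qed
  have 2: "{y \<in> ?W. E *\<^sub>v y = 0\<^sub>v n} = deep_ker n U k (F - E)"
  proof safe
    fix y assume "y \<in> ?W" and Ey: "E *\<^sub>v y = 0\<^sub>v n"
    then obtain x where x: "x \<in> cv" "y \<in> cv" "U *\<^sub>v y = 0\<^sub>v n" "y = U ^\<^sub>m k *\<^sub>v (F *\<^sub>v x)"
      by (auto simp: deep_ker_def)
    have "U ^\<^sub>m k *\<^sub>v (E *\<^sub>v x) = 0\<^sub>v n" using Ey x F by (simp add: com EEv)
    hence "y = U ^\<^sub>m k *\<^sub>v ((F - E) *\<^sub>v x)"
      using x F E P by (simp add: vec_simps)
    thus "y \<in> deep_ker n U k (F - E)" using x by (auto simp: deep_ker_def)
  next
    fix y assume "y \<in> deep_ker n U k (F - E)"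
    then obtain x where x: "x \<in> cv" "y \<in> cv" "U *\<^sub>v y = 0\<^sub>v n" "y = U ^\<^sub>m k *\<^sub>v ((F - E) *\<^sub>v x)"
      by (auto simp: deep_ker_def)
    have E0: "E *\<^sub>v ((F - E) *\<^sub>v x) = 0\<^sub>v n" using x F E by (simp add: vec_simps EEv)
    show "E *\<^sub>v y = 0\<^sub>v n" unfolding x(4) using x(1) E F P
      by (subst com(1)) (simp_all add: E0 vec_simps(10) minus_carrier_mat)
    have "F *\<^sub>v ((F - E) *\<^sub>v x) = (F - E) *\<^sub>v x" using x F E by (simp add: vec_simps EEv)
    hence "y = U ^\<^sub>m k *\<^sub>v (F *\<^sub>v ((F - E) *\<^sub>v x))" using x(4) by simp
    moreover have "(F - E) *\<^sub>v x \<in> cv" using x F E by (intro sq_closed) auto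
    ultimately show "y \<in> ?W" using x unfolding deep_ker_def by blast
  qed
  show ?thesis using dim_sub_mult_mat[OF E vec_subspace_deep_ker[OF U F, of k]] unfolding 1 2 .
qed

end

context cyclic_pair
begin

text \<open>
  On \<open>K[t]/(d)\<close> the eigenvectors for a root \<open>e\<close> of \<open>d\<close> are the multiples of \<open>d / (t - e)\<close>, a line.
  It lies in the image of \<open>(t - e)\<^sup>k\<close> exactly if \<open>(t - e)\<^bsup>k+1\<^esup>\<close> divides \<open>d\<close>: a cyclic summand has one
  Jordan block for each root.
\<close>

lemma dim_sub_deep_ker_proj:
  "dim_sub n (deep_ker n (char_matrix A e) k proj) = (if k < order e d then 1 else 0)"
proof (cases "k < order e d")
  case False
  have "d \<noteq> 0" using deg by auto
  with False show ?thesis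
    using deep_ker_beyond_order[OF A proj_closed _ d_proj, of e k] by (simp add: dim_sub_zero)
next
  case True
  let ?U = "char_matrix A e" and ?l = "[:-e, 1:]"
  have d0: "d \<noteq> 0" using deg by auto
  have "?l ^ Suc k dvd d" using True by (meson Suc_leI order_1 power_le_dvd)
  then obtain h where h: "d = ?l ^ Suc k * h" by (elim dvdE)
  hence h0: "h \<noteq> 0" using d0 by auto
  let ?g = "?l ^ k * h"
  have dg: "d = ?l * ?g" unfolding h by (simp add: ac_simps)
  let ?y = "poly_mat A ?g *\<^sub>v v"
  have y: "?y \<in> cv" by simp
  have "degree d = Suc (degree ?g)"
    unfolding dg using h0 by (subst degree_mult_eq) auto
  hence "\<not> d dvd ?g"
    using h0 by (metis dvd_imp_degree_le lessI linorder_not_less mult_eq_0_iff power_not_zero pCons_eq_0_iff zero_neq_one)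
  hence y0: "?y \<noteq> 0\<^sub>v n" by (simp add: poly_mat_v_eq_0_iff)
  have Uk: "?U ^\<^sub>m k = poly_mat A (?l ^ k)" by (simp add: poly_mat_power char_matrix_poly_mat)
  have Uy: "?U *\<^sub>v ?y = 0\<^sub>v n"
    unfolding char_matrix_poly_mat[OF A] poly_mat_vec_mult[OF A v] poly_mat_v_eq_0_iff dg[symmetric] by simp
  have "deep_ker n ?U k proj = range (\<lambda>a. a \<cdot>\<^sub>v ?y)"
  proof safe
    fix z assume "z \<in> deep_ker n ?U k proj"
    then obtain x where z: "z \<in> cv" "?U *\<^sub>v z = 0\<^sub>v n" and x: "x \<in> cv"
      and zx: "z = ?U ^\<^sub>m k *\<^sub>v (proj *\<^sub>v x)" by (auto simp: deep_ker_def)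
    obtain f0 where "proj *\<^sub>v x = poly_mat A f0 *\<^sub>v v" using proj_range[OF x] by blast
    hence zf: "z = poly_mat A (?l ^ k * f0) *\<^sub>v v" using zx by (simp add: Uk poly_mat_vec_mult)
    define f where "f = ?l ^ k * f0"
    have "poly_mat A (?l * f) *\<^sub>v v = 0\<^sub>v n"
      using z(2) zf unfolding f_def by (simp add: char_matrix_poly_mat poly_mat_vec_mult)
    hence "?l * ?g dvd ?l * f" unfolding poly_mat_v_eq_0_iff dg[symmetric] .
    hence "?g dvd f" by (simp only: dvd_mult_cancel_left) simp
    then obtain r where r: "f = r * ?g" by (metis dvdE mult.commute)
    have "z = poly_mat A r *\<^sub>v ?y" unfolding zf f_def[symmetric] r by (simp add: poly_mat_vec_mult)
    also have "\<dots> = poly r e \<cdot>\<^sub>v ?y" by (rule poly_mat_eigen[OF A y Uy])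
    finally show "z \<in> range (\<lambda>a. a \<cdot>\<^sub>v ?y)" by blast
  next
    fix a
    have "a \<cdot>\<^sub>v ?y = ?U ^\<^sub>m k *\<^sub>v (proj *\<^sub>v (poly_mat A h *\<^sub>v (a \<cdot>\<^sub>v v)))"
      by (simp add: vec_simps proj_poly_mat Uk poly_mat_vec_mult)
    moreover have "?U *\<^sub>v (a \<cdot>\<^sub>v ?y) = 0\<^sub>v n"
      by (simp add: vec_simps Uy zero_smult_vec)
    moreover have "poly_mat A h *\<^sub>v (a \<cdot>\<^sub>v v) \<in> cv" by (rule sq_closed) auto
    ultimately show "a \<cdot>\<^sub>v ?y \<in> deep_ker n ?U k proj"
      using y unfolding deep_ker_def by fastforce
  qed
  thus ?thesis using True dim_sub_line[OF y y0] by simp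
qed

section \<open>Skew roots on a cyclic summand\<close>

text \<open>
  The matrix \<open>S\<close> realises the map \<open>f(t) \<mapsto> g(t) f(c - t)\<close> on \<open>K[t]/(d)\<close>. In the formula for the
  projection, the powers \<open>A\<^sup>i\<close> on the left of \<open>v\<close> are replaced by \<open>g(A) (c - A)\<^sup>i\<close>. The telescoping
  identity turns \<open>S A = (c - A) S\<close> into \<open>g(A) d(c - A) v = 0\<close>, which holds because \<open>d\<close> divides
  \<open>g(t) d(c - t)\<close>.
\<close>

lemma skew_root_exists:
  fixes c :: 'a and g :: "'a poly"
  defines "r \<equiv> [:c, -1:]"
  assumes g: "g * (g \<circ>\<^sub>p r) = [:0, 1:] * r" and dvd: "d dvd g * (d \<circ>\<^sub>p r)"
  shows "\<exists>S\<in>sq. proj * S = S \<and> S * proj = S \<and> S * A = poly_mat A r * S \<and>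
    S * S = A * poly_mat A r * proj"
proof -
  define C where "C = poly_mat A r"
  define G where "G = poly_mat A g"
  have C [simp]: "C \<in> sq" and G [simp]: "G \<in> sq" by (auto simp: C_def G_def)
  have pmC: "poly_mat C f = poly_mat A (f \<circ>\<^sub>p r)" for f by (simp add: C_def poly_mat_pcompose)
  let ?B = "bezoutian C u A d"
  have B [simp]: "?B \<in> sq" by (rule bezoutian_closed) auto
  \<comment> \<open>The factor \<open>proj\<close> makes \<open>S\<close> vanish on the complementary summand.\<close>
  define S where "S = G * ?B * proj"
  have S [simp]: "S \<in> sq" by (simp add: S_def)
  have "C * ?B - ?B * A = poly_mat C d * u - u * poly_mat A d" by (rule bezoutian_telescope) auto
  also have "\<dots> = poly_mat C d * u" unfolding w_d
    by (rule sq_eqI) (auto simp: sq_index simp del: index_mult_mat(1))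
  finally have CB: "C * ?B = ?B * A + poly_mat C d * u" by (intro sq_diffD) auto
  obtain h where h: "g * (d \<circ>\<^sub>p r) = h * d" using dvd by (metis dvdE mult.commute)
  have "G * (poly_mat C d * u) = poly_mat A (h * d) * u"
    unfolding pmC G_def h[symmetric] by (simp add: poly_mat_mult sq_simps)
  also have "\<dots> = 0\<^sub>m n n" by (simp add: poly_mat_mult sq_simps d_u)
  finally have Gd: "G * (poly_mat C d * u) = 0\<^sub>m n n" .
  have GC: "C * G = G * C" unfolding C_def G_def by (rule poly_mat_commutes) simp
  have CGB: "C * (G * ?B) = G * (C * ?B)" by (metis B C G GC sq_simps(1))
  have "C * (G * ?B) = G * (?B * A)"
    unfolding CGB CB by (simp add: sq_simps Gd)
  hence "C * (G * ?B) = (G * ?B) * A" by (simp add: sq_simps)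
  hence CS: "C * S = S * A"
    unfolding S_def by (metis A B C G proj_closed proj_commute sq_closed(1) sq_simps(1))
  have Sv: "S *\<^sub>v v = poly_mat A g *\<^sub>v v"
    using proj_poly_mat[of 1] by (simp add: S_def vec_simps bezoutian_d_v G_def)
  have Spm: "S *\<^sub>v (poly_mat A f *\<^sub>v v) = poly_mat A ((f \<circ>\<^sub>p r) * g) *\<^sub>v v" for f
  proof -
    have "poly_mat C f * S = S * poly_mat A f" using CS by (intro poly_mat_intertwine) auto
    hence "S *\<^sub>v (poly_mat A f *\<^sub>v v) = poly_mat C f *\<^sub>v (S *\<^sub>v v)"
      by (metis A C S poly_mat_closed v vec_simps(1))
    thus ?thesis by (simp add: Sv pmC poly_mat_vec_mult)
  qed
  have rr: "r \<circ>\<^sub>p r = [:0, 1:]" by (simp add: r_def pcompose_pCons)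
  have SSpm: "S *\<^sub>v (S *\<^sub>v (poly_mat A f *\<^sub>v v)) = poly_mat A ([:0, 1:] * r) *\<^sub>v (poly_mat A f *\<^sub>v v)" for f
  proof -
    have "(((f \<circ>\<^sub>p r) * g) \<circ>\<^sub>p r) * g = ((f \<circ>\<^sub>p r) \<circ>\<^sub>p r) * (g * (g \<circ>\<^sub>p r))"
      by (simp add: pcompose_mult ac_simps)
    also have "(f \<circ>\<^sub>p r) \<circ>\<^sub>p r = f" by (simp add: pcompose_assoc[symmetric] rr)
    finally show ?thesis unfolding Spm g by (simp only: poly_mat_vec_mult A v mult.commute)
  qed
  have Sproj: "S * proj = S" unfolding S_def by (simp add: sq_simps proj_idem)
  have Svec: "S *\<^sub>v x = S *\<^sub>v (proj *\<^sub>v x)" if "x \<in> cv" for x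
    using that Sproj by (metis S proj_closed vec_simps(1))
  have "proj * S = S"
  proof (rule mat_eq_vecI)
    fix x :: "'a vec" assume x: "x \<in> cv"
    then obtain f where f: "proj *\<^sub>v x = poly_mat A f *\<^sub>v v" using proj_range by blast
    show "proj * S *\<^sub>v x = S *\<^sub>v x"
      using x Svec[OF x] by (simp add: vec_simps f Spm proj_poly_mat)
  qed auto
  moreover have "S * S = A * C * proj"
  proof (rule mat_eq_vecI)
    fix x :: "'a vec" assume x: "x \<in> cv"
    then obtain f where f: "proj *\<^sub>v x = poly_mat A f *\<^sub>v v" using proj_range by blast
    have "S * S *\<^sub>v x = poly_mat A ([:0, 1:] * r) *\<^sub>v (poly_mat A f *\<^sub>v v)"
      using x Svec[OF x] by (simp add: vec_simps f SSpm)
    also have "poly_mat A ([:0, 1:] * r) = A * C" by (simp only: poly_mat_mult A poly_mat_X C_def)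
    finally show "S * S *\<^sub>v x = A * C * proj *\<^sub>v x" using x by (simp add: vec_simps f)
  qed auto
  ultimately show ?thesis using S Sproj CS unfolding C_def by metis
qed

end

section \<open>Vectors with largest annihilator\<close>

lemma field_poly_prime_factor:
  fixes g :: "'a::field poly"
  assumes "degree g > 0"
  shows "\<exists>p. prime_elem p \<and> p dvd g"
  using assms
proof (induction "degree g" arbitrary: g rule: less_induct)
  case less
  show ?case
  proof (cases "irreducible g")
    case True
    from field_poly_irreducible_imp_prime[OF this] show ?thesis by (intro exI[of _ g]) simp
  next
    case False
    have g: "g \<noteq> 0" using less.prems by auto
    hence "\<not> is_unit g" using less.prems by (simp add: is_unit_iff_degree)
    with g False obtain a b where ab: "g = a * b" "\<not> is_unit a" "\<not> is_unit b"
      unfolding irreducible_def by blast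
    with g have nz: "a \<noteq> 0" "b \<noteq> 0" by auto
    with ab(2,3) have "degree a > 0" "degree b > 0" by (simp_all add: is_unit_iff_degree)
    moreover from this have "degree a < degree g" using nz by (simp add: ab(1) degree_mult_eq)
    ultimately obtain p where "prime_elem p" "p dvd a" using less.hyps[of a] by blast
    thus ?thesis using ab(1) by (intro exI[of _ p]) simp
  qed
qed

text \<open>
  A comparison of prime factorisations, with \<open>b\<close> the exact exponent of \<open>p\<close> in \<open>d\<close>. The induction
  cancels a common prime factor of \<open>g\<close> and \<open>d\<close>.
\<close>

lemma not_dvd_imp_prime_power:
  fixes g d :: "'a::field poly"
  assumes "g \<noteq> 0" "d \<noteq> 0" "\<not> g dvd d"
  shows "\<exists>p b. prime_elem p \<and> p ^ Suc b dvd g \<and> p ^ b dvd d \<and> \<not> p ^ Suc b dvd d"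
  using assms
proof (induction "degree g" arbitrary: g d rule: less_induct)
  case less
  have "degree g > 0" using less.prems by (metis is_unit_iff_degree unit_imp_dvd gr0I)
  then obtain p where p: "prime_elem p" "p dvd g" using field_poly_prime_factor by blast
  show ?case
  proof (cases "p dvd d")
    case False
    thus ?thesis using p by (intro exI[of _ p] exI[of _ 0]) auto
  next
    case True
    then obtain d' g' where d': "d = p * d'" and g': "g = p * g'" using p(2) by (elim dvdE)
    have nz: "p \<noteq> 0" "g' \<noteq> 0" "d' \<noteq> 0" using less.prems d' g' by auto
    have "degree p > 0" using p(1) nz by (metis is_unit_iff_degree prime_elem_not_unit gr0I)
    hence "degree g' < degree g" using nz by (simp add: g' degree_mult_eq)
    moreover have "\<not> g' dvd d'" using less.prems d' g' by auto
    ultimately obtain q b where q: "prime_elem q" "q ^ Suc b dvd g'" "q ^ b dvd d'" "\<not> q ^ Suc b dvd d'"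
      using less.hyps[of g' d'] nz by blast
    show ?thesis
    proof (cases "q dvd p")
      case True
      then obtain t where t: "p = q * t" by (elim dvdE)
      have "is_unit t"
        using p(1) q(1) t by (metis irreducible_def prime_elem_imp_irreducible prime_elem_not_unit)
      have q0: "q \<noteq> 0" using q(1) by auto
      have "q ^ Suc (Suc b) dvd g" unfolding g' t using q(2)
        by (metis dvd_mult dvd_mult_cancel_left mult.assoc mult.commute power_Suc)
      moreover have "q ^ Suc b dvd d" unfolding d' t using q(3)
        by (metis dvd_mult dvd_mult_cancel_left mult.assoc mult.commute power_Suc)
      moreover have "\<not> q ^ Suc (Suc b) dvd d"
      proof
        assume "q ^ Suc (Suc b) dvd d"
        hence "q * q ^ Suc b dvd q * (t * d')" unfolding d' t by (simp add: mult.assoc)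
        hence "q ^ Suc b dvd t * d'" using q0 dvd_mult_cancel_left by blast
        with \<open>is_unit t\<close> have "q ^ Suc b dvd d'" by (metis dvd_mult_unit_iff')
        with q(4) show False by simp
      qed
      ultimately show ?thesis using q(1) by blast
    next
      case False
      have "q ^ Suc b dvd g" "q ^ b dvd d" using q by (auto simp: g' d' intro: dvd_mult)
      moreover have "\<not> q ^ Suc b dvd d"
      proof
        assume "q ^ Suc b dvd d"
        then obtain i j where ij: "i + j = Suc b" "q ^ i dvd p" "q ^ j dvd d'"
          unfolding d' using prime_elem_power_dvd_prod[OF _ q(1)] by blast
        with False have "i = 0" by (metis dvd_power dvd_trans gr0I)
        with ij q(4) show False by simp
      qed
      ultimately show ?thesis using q(1) by blast
    qed
  qed
qed

context square
begin

definition annihilator :: "'a::field mat \<Rightarrow> 'a vec \<Rightarrow> 'a poly \<Rightarrow> bool" where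
  "annihilator A v d \<longleftrightarrow> d \<noteq> 0 \<and> (\<forall>f. poly_mat A f *\<^sub>v v = 0\<^sub>v n \<longleftrightarrow> d dvd f)"

lemma annihilatorD:
  assumes "annihilator A v d"
  shows "d \<noteq> 0" and "poly_mat A f *\<^sub>v v = 0\<^sub>v n \<longleftrightarrow> d dvd f"
  using assms unfolding annihilator_def by blast+

lemma annihilatorI:
  assumes "d \<noteq> 0" and "\<And>f. poly_mat A f *\<^sub>v v = 0\<^sub>v n \<longleftrightarrow> d dvd f"
  shows "annihilator A v d"
  using assms unfolding annihilator_def by blast

lemma poly_mat_index:
  assumes A: "A \<in> sq" and v: "v \<in> cv" and i: "i < n" and "degree p < m"
  shows "vec_index (poly_mat A p *\<^sub>v v) i = (\<Sum>j<m. coeff p j * vec_index (A ^\<^sub>m j *\<^sub>v v) i)"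
  using assms(2,4)
proof (induction p arbitrary: v m)
  case 0
  thus ?case using i by (simp add: vec_simps)
next
  case (pCons a p)
  then obtain m' where m: "m = Suc m'" by (cases m) auto
  have "poly_mat A (pCons a p) *\<^sub>v v = a \<cdot>\<^sub>v v + poly_mat A p *\<^sub>v (A *\<^sub>v v)"
    using A pCons.prems poly_mat_commute[OF A A, of p]
    by (simp add: poly_mat_pCons vec_simps) (metis poly_mat_closed vec_simps(1))
  hence "vec_index (poly_mat A (pCons a p) *\<^sub>v v) i = a * vec_index v i + vec_index (poly_mat A p *\<^sub>v (A *\<^sub>v v)) i"
    using index_add_vec(1)[of i "poly_mat A p *\<^sub>v (A *\<^sub>v v)" "a \<cdot>\<^sub>v v"] i pCons.prems(1)
      carrier_vecD[OF sq_closed(2)[OF poly_mat_closed[OF A] sq_closed(2)[OF A pCons.prems(1)]], of p]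
    by (metis carrier_vecD index_smult_vec(1))
  also have "vec_index (poly_mat A p *\<^sub>v (A *\<^sub>v v)) i = (\<Sum>j<m'. coeff p j * vec_index (A ^\<^sub>m j *\<^sub>v (A *\<^sub>v v)) i)"
  proof (cases "p = 0")
    case True
    thus ?thesis using i A pCons.prems by (simp add: vec_simps del: index_mult_mat_vec)
  next
    case False
    thus ?thesis using pCons.prems m A by (intro pCons.IH) auto
  qed
  also have "a * vec_index v i + \<dots> = (\<Sum>j<m. coeff (pCons a p) j * vec_index (A ^\<^sub>m j *\<^sub>v v) i)"
    unfolding m sum.lessThan_Suc_shift using A pCons.prems(1) i
    by (simp add: pow_mat_Suc_vec(2)[OF A] vec_simps carrier_matD[OF A] del: pow_mat.simps(2) index_mult_mat_vec)
  finally show ?case .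
qed

text \<open>
  The vectors \<open>v, A v, \<dots>, A\<^sup>n v\<close> are \<open>n + 1\<close> vectors of length \<open>n\<close>. Padded with a zero row they form a
  singular square matrix, and a kernel vector of it lists the coefficients of \<open>p\<close>.
\<close>

lemma annihilating_poly:
  fixes A :: "'a::field mat"
  assumes A: "A \<in> sq" and v: "v \<in> cv"
  shows "\<exists>p. p \<noteq> 0 \<and> degree p \<le> n \<and> poly_mat A p *\<^sub>v v = 0\<^sub>v n"
proof -
  let ?M = "mat (Suc n) (Suc n) (\<lambda>(i, j). if i < n then vec_index (A ^\<^sub>m j *\<^sub>v v) i else 0)"
  have M: "?M \<in> carrier_mat (Suc n) (Suc n)" by simp
  have "transpose_mat ?M *\<^sub>v unit_vec (Suc n) n = 0\<^sub>v (Suc n)"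
    by (intro eq_vecI) auto
  moreover have "unit_vec (Suc n) n \<noteq> (0\<^sub>v (Suc n) :: 'a vec)" by simp
  moreover have "unit_vec (Suc n) n \<in> carrier_vec (Suc n)" by simp
  moreover have "transpose_mat ?M \<in> carrier_mat (Suc n) (Suc n)" by simp
  ultimately have "det (transpose_mat ?M) = 0"
    using det_0_iff_vec_prod_zero_field by blast
  hence "det ?M = 0" using det_transpose[OF M] by simp
  then obtain c where c: "c \<in> carrier_vec (Suc n)" "c \<noteq> 0\<^sub>v (Suc n)" "?M *\<^sub>v c = 0\<^sub>v (Suc n)"
    using det_0_iff_vec_prod_zero_field[OF M] by blast
  define p where "p = Poly (list_of_vec c)"
  have coeff: "coeff p j = (if j < Suc n then vec_index c j else 0)" for j
    using c(1) by (auto simp: p_def nth_default_def list_of_vec_index)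
  have deg: "degree p \<le> n" by (rule degree_le) (simp add: coeff)
  have "\<exists>j<Suc n. vec_index c j \<noteq> 0"
    using c(1,2) by (metis carrier_vecD eq_vecI index_zero_vec)
  hence "p \<noteq> 0" using coeff by (metis coeff_0)
  moreover have "poly_mat A p *\<^sub>v v = 0\<^sub>v n"
  proof (rule eq_vecI)
    fix i assume "i < dim_vec (0\<^sub>v n :: 'a vec)"
    hence i: "i < n" by simp
    have "vec_index (poly_mat A p *\<^sub>v v) i = (\<Sum>j<Suc n. coeff p j * vec_index (A ^\<^sub>m j *\<^sub>v v) i)"
      by (rule poly_mat_index[OF A v i]) (use deg in simp)
    also have "\<dots> = vec_index (?M *\<^sub>v c) i"
      using i c(1) by (simp add: scalar_prod_def coeff mult.commute lessThan_atLeast0 del: sum.lessThan_Suc sum.op_ivl_Suc)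
    finally show "vec_index (poly_mat A p *\<^sub>v v) i = vec_index (0\<^sub>v n) i" using c(3) i by simp
  qed (use A in \<open>simp add: carrier_matD[OF poly_mat_closed]\<close>)
  ultimately show ?thesis using deg by blast
qed

lemma annihilator_exists:
  fixes A :: "'a::field mat"
  assumes A: "A \<in> sq" and v: "v \<in> cv"
  shows "\<exists>d. annihilator A v d \<and> degree d \<le> n"
proof -
  let ?P = "\<lambda>p. p \<noteq> 0 \<and> degree p \<le> n \<and> poly_mat A p *\<^sub>v v = 0\<^sub>v n"
  obtain p0 where p0: "?P p0" using annihilating_poly[OF A v] by blast
  obtain d where d: "?P d" and min: "\<And>p. ?P p \<Longrightarrow> degree d \<le> degree p"
    using ex_has_least_nat[of ?P p0 degree] p0 by blast
  have "poly_mat A f *\<^sub>v v = 0\<^sub>v n \<longleftrightarrow> d dvd f" for f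
  proof
    assume f0: "poly_mat A f *\<^sub>v v = 0\<^sub>v n"
    have "poly_mat A f = poly_mat A (f div d * d + f mod d)" by simp
    also have "\<dots> = poly_mat A (f div d) * poly_mat A d + poly_mat A (f mod d)" by (simp only: poly_mat_add poly_mat_mult A)
    finally have r0: "poly_mat A (f mod d) *\<^sub>v v = 0\<^sub>v n" using f0 d A v by (simp add: vec_simps)
    have "f mod d = 0"
    proof (rule ccontr)
      assume r: "f mod d \<noteq> 0"
      hence lt: "degree (f mod d) < degree d" using degree_mod_less d by blast
      with r r0 d have "?P (f mod d)" by simp
      from min[OF this] lt show False by simp
    qed
    thus "d dvd f" by (simp add: mod_eq_0_iff_dvd)
  next
    assume "d dvd f"
    then obtain g where "f = g * d" by (metis dvdE mult.commute)
    thus "poly_mat A f *\<^sub>v v = 0\<^sub>v n" using A v d by (simp add: poly_mat_mult vec_simps)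
  qed
  thus ?thesis using d unfolding annihilator_def by blast
qed

lemma annihilator_factor:
  assumes A: "A \<in> sq" and v: "v \<in> cv" and ann: "annihilator A v (r * s)"
  shows "annihilator A (poly_mat A r *\<^sub>v v) s"
proof -
  have nz: "r \<noteq> 0" "s \<noteq> 0" using annihilatorD(1)[OF ann] by auto
  show ?thesis
  proof (rule annihilatorI[OF nz(2)])
    fix f
    have "poly_mat A f *\<^sub>v (poly_mat A r *\<^sub>v v) = 0\<^sub>v n \<longleftrightarrow> r * s dvd r * f"
      unfolding annihilatorD(2)[OF ann, symmetric] poly_mat_vec_mult[OF A v] by (simp only: mult.commute)
    thus "poly_mat A f *\<^sub>v (poly_mat A r *\<^sub>v v) = 0\<^sub>v n \<longleftrightarrow> s dvd f" using nz by simp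
  qed
qed

text \<open>
  If \<open>f\<close> annihilates \<open>v + w\<close>, then \<open>q f\<close> annihilates \<open>w\<close> and \<open>p\<^sup>k f\<close> annihilates \<open>v\<close>. As \<open>p\<^sup>k\<close>
  and \<open>q\<close> are coprime, both divide \<open>f\<close>, hence so does their product.
\<close>

lemma annihilator_coprime_sum:
  assumes A: "A \<in> sq" and v: "v \<in> cv" and w: "w \<in> cv" and p: "prime_elem p" and nd: "\<not> p dvd q"
    and av: "annihilator A v q" and aw: "annihilator A w (p ^ k)"
  shows "annihilator A (v + w) (p ^ k * q)"
proof -
  have nz: "q \<noteq> 0" "p \<noteq> 0" using annihilatorD(1)[OF av] p by auto
  have cop1: "p ^ k dvd f" if "p ^ k dvd q * f" for f k
  proof -
    from that obtain i j where ij: "i + j = k" "p ^ i dvd q" "p ^ j dvd f"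
      using prime_elem_power_dvd_prod[OF _ p] by blast
    with nd have "i = 0" by (metis dvd_power dvd_trans gr0I)
    with ij show ?thesis by simp
  qed
  have cop2: "q dvd f" if "q dvd p ^ k * f" for f
  proof -
    from that obtain h where h: "p ^ k * f = q * h" by (elim dvdE)
    hence "p ^ k dvd q * h" by (metis dvd_triv_left)
    then obtain h' where "h = p ^ k * h'" using cop1 by (meson dvdE)
    with h nz have "f = q * h'" by (simp add: mult.left_commute)
    thus ?thesis by simp
  qed
  have sum: "poly_mat A f *\<^sub>v (v + w) = poly_mat A f *\<^sub>v v + poly_mat A f *\<^sub>v w" for f
    using A v w by (simp add: vec_simps)
  have "poly_mat A f *\<^sub>v (v + w) = 0\<^sub>v n \<longleftrightarrow> p ^ k * q dvd f" for f
  proof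
    assume 0: "poly_mat A f *\<^sub>v (v + w) = 0\<^sub>v n"
    have 1: "poly_mat A (q * f) *\<^sub>v v = 0\<^sub>v n" "poly_mat A (p ^ k * f) *\<^sub>v w = 0\<^sub>v n"
      by (simp_all only: annihilatorD(2)[OF av] annihilatorD(2)[OF aw] dvd_triv_left)
    have vw: "v + w \<in> cv" using v w by simp
    have 2: "poly_mat A (g * f) *\<^sub>v (v + w) = 0\<^sub>v n" for g
      unfolding poly_mat_vec_mult[OF A vw, symmetric] 0 using A by (simp add: vec_simps)
    have "0\<^sub>v n + poly_mat A (q * f) *\<^sub>v w = 0\<^sub>v n" "poly_mat A (p ^ k * f) *\<^sub>v v + 0\<^sub>v n = 0\<^sub>v n"
      using 2[of q] 2[of "p ^ k"] unfolding sum 1 .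
    hence "poly_mat A (q * f) *\<^sub>v w = 0\<^sub>v n" "poly_mat A (p ^ k * f) *\<^sub>v v = 0\<^sub>v n"
      using A v w by simp_all
    hence "p ^ k dvd q * f" "q dvd p ^ k * f"
      by (simp_all only: annihilatorD(2)[OF av] annihilatorD(2)[OF aw])
    hence *: "p ^ k dvd f" "q dvd f" using cop1 cop2 by blast+
    then obtain h where h: "f = q * h" by (elim dvdE)
    have "p ^ k dvd h" using cop1[of k h] *(1) unfolding h by blast
    thus "p ^ k * q dvd f" unfolding h by (metis dvd_refl mult.commute mult_dvd_mono)
  next
    assume "p ^ k * q dvd f"
    hence "p ^ k dvd f" "q dvd f" by (meson dvd_mult_left dvd_mult_right)+
    hence "poly_mat A f *\<^sub>v v = 0\<^sub>v n" "poly_mat A f *\<^sub>v w = 0\<^sub>v n"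
      unfolding annihilatorD(2)[OF av] annihilatorD(2)[OF aw] by blast+
    thus "poly_mat A f *\<^sub>v (v + w) = 0\<^sub>v n" by (simp only: sum) simp
  qed
  thus ?thesis using nz by (intro annihilatorI) auto
qed

text \<open>
  Suppose that the annihilator \<open>g\<close> of \<open>w\<close> does not divide \<open>d\<close>. Some prime \<open>p\<close> then has a higher
  exponent in \<open>g\<close> than its exponent \<open>b\<close> in \<open>d\<close>. Multiplying \<open>v\<close> by \<open>p\<^sup>b\<close> and \<open>w\<close> by the cofactor
  of \<open>p\<^bsup>b+1\<^esup>\<close> in \<open>g\<close> produces vectors whose annihilators are coprime, and the annihilator of their sum
  is \<open>p d\<close>, of larger degree than \<open>d\<close>.
\<close>

lemma max_annihilator_kills:
  fixes A F :: "'a::field mat"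
  assumes A: "A \<in> sq" and F: "F \<in> sq" and com: "A * F = F * A"
    and v: "v \<in> cv" "F *\<^sub>v v = v" and d: "annihilator A v d"
    and max: "\<And>x e. x \<in> cv \<Longrightarrow> F *\<^sub>v x = x \<Longrightarrow> annihilator A x e \<Longrightarrow> degree e \<le> degree d"
    and w: "w \<in> cv" "F *\<^sub>v w = w"
  shows "poly_mat A d *\<^sub>v w = 0\<^sub>v n"
proof -
  obtain g where g: "annihilator A w g" using annihilator_exists[OF A w(1)] by blast
  have nz: "g \<noteq> 0" "d \<noteq> 0" using annihilatorD(1) d g by blast+
  have Fpm: "F *\<^sub>v (poly_mat A f *\<^sub>v x) = poly_mat A f *\<^sub>v x" if "x \<in> cv" "F *\<^sub>v x = x" for f x
    using poly_mat_commute[OF A F com, of f] that A F by (metis poly_mat_closed vec_simps(1))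
  have "g dvd d"
  proof (rule ccontr)
    assume "\<not> g dvd d"
    from not_dvd_imp_prime_power[OF nz this]
    obtain p b where p: "prime_elem p" "p ^ Suc b dvd g" "p ^ b dvd d" "\<not> p ^ Suc b dvd d"
      by blast
    obtain q where q: "d = p ^ b * q" using p(3) by (elim dvdE)
    obtain s where s: "g = s * p ^ Suc b" using p(2) by (metis dvdE mult.commute)
    have nd: "\<not> p dvd q" using p(4) unfolding q by (auto simp: mult_dvd_mono)
    let ?v = "poly_mat A (p ^ b) *\<^sub>v v" and ?w = "poly_mat A s *\<^sub>v w"
    have cv: "?v \<in> cv" "?w \<in> cv" using A v w by auto
    have "annihilator A (?v + ?w) (p ^ Suc b * q)"
      using annihilator_factor[OF A v(1)] annihilator_factor[OF A w(1)] d g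
      by (intro annihilator_coprime_sum A cv p(1) nd) (simp_all add: q s)
    moreover have "F *\<^sub>v (?v + ?w) = ?v + ?w"
      using cv F v w by (simp add: vec_simps Fpm)
    ultimately have "degree (p ^ Suc b * q) \<le> degree d" using max cv by (metis add_carrier_vec)
    moreover have "degree p > 0"
      using p(1) by (metis is_unit_iff_degree prime_elem_def gr0I)
    moreover have "p \<noteq> 0" "q \<noteq> 0" using p(1) q nz by auto
    ultimately show False by (simp add: q degree_mult_eq degree_power_eq)
  qed
  thus ?thesis using annihilatorD(2)[OF g] by simp
qed

section \<open>Existence of cyclic summands\<close>

text \<open>
  A linear map onto the span of \<open>v, A v, \<dots>, A\<^bsup>k-1\<^esup> v\<close> that fixes this span. It serves to separate the
  next power \<open>A\<^sup>k v\<close> from the span by a functional.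
\<close>

definition krylov_proj :: "'a::field mat \<Rightarrow> 'a vec \<Rightarrow> nat \<Rightarrow> 'a mat \<Rightarrow> bool" where
  "krylov_proj A v k R \<longleftrightarrow> R \<in> sq \<and> (\<forall>j<k. R *\<^sub>v (A ^\<^sub>m j *\<^sub>v v) = A ^\<^sub>m j *\<^sub>v v) \<and>
     (\<forall>x\<in>cv. \<exists>f. (f = 0 \<or> degree f < k) \<and> R *\<^sub>v x = poly_mat A f *\<^sub>v v)"

text \<open>
  The vector \<open>y = A\<^sup>k v - R A\<^sup>k v\<close> is \<open>q(A) v\<close> for a polynomial \<open>q\<close> of degree \<open>k\<close>, hence nonzero. The
  functional is a coordinate of \<open>x - R x\<close> that does not vanish at \<open>y\<close>, suitably scaled.
\<close>

lemma separating_functional: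
  fixes A :: "'a::field mat"
  assumes A: "A \<in> sq" and v: "v \<in> cv" and ann: "annihilator A v d" and k: "k < degree d"
    and R: "krylov_proj A v k R"
  shows "\<exists>w\<in>cv. (\<forall>j<k. w \<bullet> (A ^\<^sub>m j *\<^sub>v v) = 0) \<and> w \<bullet> (A ^\<^sub>m k *\<^sub>v v) = 1"
proof -
  have Rsq: "R \<in> sq" and fix_pow: "\<And>j. j < k \<Longrightarrow> R *\<^sub>v (A ^\<^sub>m j *\<^sub>v v) = A ^\<^sub>m j *\<^sub>v v"
    and range: "\<And>x. x \<in> cv \<Longrightarrow> \<exists>f. (f = 0 \<or> degree f < k) \<and> R *\<^sub>v x = poly_mat A f *\<^sub>v v"
    using R by (auto simp: krylov_proj_def)
  have Av: "A ^\<^sub>m j *\<^sub>v v \<in> cv" for j using A v by (intro sq_closed) auto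
  obtain f where f: "f = 0 \<or> degree f < k" "R *\<^sub>v (A ^\<^sub>m k *\<^sub>v v) = poly_mat A f *\<^sub>v v"
    using range[OF Av] by blast
  let ?q = "[:0, 1:] ^ k - f" and ?Q = "1\<^sub>m n - R"
  have Q: "?Q \<in> sq" using Rsq by (intro sq_closed) auto
  have "[:0, 1:] ^ k = monom (1 :: 'a) k" by (simp add: monom_altdef)
  hence "coeff ([:0, 1:] ^ k :: 'a poly) k = 1" by simp
  moreover have "coeff f k = 0" using f(1) by (auto intro: coeff_eq_0)
  ultimately have "coeff ?q k = 1" by simp
  hence q0: "?q \<noteq> 0" by (metis coeff_0 zero_neq_one)
  have "degree ?q \<le> k" using f(1) by (intro degree_diff_le) (auto simp: degree_power_eq)
  hence "\<not> d dvd ?q" using k q0 by (meson dvd_imp_degree_le le_trans not_less)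
  hence "poly_mat A ?q *\<^sub>v v \<noteq> 0\<^sub>v n" using annihilatorD(2)[OF ann] by blast
  moreover have "poly_mat A ?q = A ^\<^sub>m k - poly_mat A f"
    using A by (simp add: poly_mat_diff poly_mat_power poly_mat_X)
  moreover have "?Q *\<^sub>v (A ^\<^sub>m k *\<^sub>v v) = A ^\<^sub>m k *\<^sub>v v - poly_mat A f *\<^sub>v v"
    using Rsq Av[of k] f(2) by (simp add: vec_simps)
  ultimately have y0: "?Q *\<^sub>v (A ^\<^sub>m k *\<^sub>v v) \<noteq> 0\<^sub>v n" using A v by (simp add: vec_simps)
  have "\<exists>i<n. vec_index (?Q *\<^sub>v (A ^\<^sub>m k *\<^sub>v v)) i \<noteq> 0"
    using y0 sq_closed(2)[OF Q Av] by (metis carrier_vecD eq_vecI index_zero_vec)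
  then obtain i where i: "i < n" "vec_index (?Q *\<^sub>v (A ^\<^sub>m k *\<^sub>v v)) i \<noteq> 0" by blast
  let ?a = "inverse (vec_index (?Q *\<^sub>v (A ^\<^sub>m k *\<^sub>v v)) i)"
  let ?w = "?a \<cdot>\<^sub>v row ?Q i"
  have row: "row ?Q i \<in> cv" using Q i(1) by (rule row_carrier_vec[rotated])
  have w: "?w \<bullet> x = ?a * vec_index (?Q *\<^sub>v x) i" if "x \<in> cv" for x
    using smult_scalar_prod_distrib[OF row that] index_mult_mat_vec[of i ?Q x] i(1)
      carrier_matD(1)[OF Q] by simp
  show ?thesis
  proof (intro bexI[of _ ?w] conjI allI impI)
    fix j assume j: "j < k"
    have "?Q *\<^sub>v (A ^\<^sub>m j *\<^sub>v v) = 0\<^sub>v n" using Rsq Av[of j] fix_pow[OF j] by (simp add: vec_simps)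
    thus "?w \<bullet> (A ^\<^sub>m j *\<^sub>v v) = 0" using w[OF Av, of j] i(1) by simp
  next
    show "?w \<bullet> (A ^\<^sub>m k *\<^sub>v v) = 1" using w[OF Av, of k] i(2) by simp
  qed (use row in simp)
qed

text \<open>
  The functional that separates \<open>A\<^sup>k v\<close> from the lower powers gives the rank one correction which makes
  the map fix \<open>A\<^sup>k v\<close> as well.
\<close>

lemma krylov_proj_exists:
  fixes A :: "'a::field mat"
  assumes A: "A \<in> sq" and v: "v \<in> cv" and ann: "annihilator A v d"
  shows "k \<le> degree d \<Longrightarrow> \<exists>R. krylov_proj A v k R"
proof (induction k)
  case 0
  have "krylov_proj A v 0 (0\<^sub>m n n)"
    unfolding krylov_proj_def by (auto intro!: exI[of _ 0] simp: vec_simps v)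
  thus ?case by blast
next
  case (Suc k)
  then obtain R where R: "krylov_proj A v k R" by auto
  hence Rsq: "R \<in> sq" and fix_pow: "\<And>j. j < k \<Longrightarrow> R *\<^sub>v (A ^\<^sub>m j *\<^sub>v v) = A ^\<^sub>m j *\<^sub>v v"
    and range: "\<And>x. x \<in> cv \<Longrightarrow> \<exists>f. (f = 0 \<or> degree f < k) \<and> R *\<^sub>v x = poly_mat A f *\<^sub>v v"
    by (auto simp: krylov_proj_def)
  have Av: "A ^\<^sub>m j *\<^sub>v v \<in> cv" for j using A v by (intro sq_closed) auto
  obtain w where w: "w \<in> cv" "\<And>j. j < k \<Longrightarrow> w \<bullet> (A ^\<^sub>m j *\<^sub>v v) = 0" "w \<bullet> (A ^\<^sub>m k *\<^sub>v v) = 1"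
    using separating_functional[OF A v ann _ R] Suc.prems by auto
  define y where "y = A ^\<^sub>m k *\<^sub>v v - R *\<^sub>v (A ^\<^sub>m k *\<^sub>v v)"
  have y: "y \<in> cv" unfolding y_def using Rsq Av[of k] by auto
  let ?R = "R + outer y w"
  have R': "?R *\<^sub>v x = R *\<^sub>v x + (w \<bullet> x) \<cdot>\<^sub>v y" if "x \<in> cv" for x
    using that Rsq w(1) y by (simp add: vec_simps outer_mult_vec)
  obtain f0 where f0: "f0 = 0 \<or> degree f0 < k" "R *\<^sub>v (A ^\<^sub>m k *\<^sub>v v) = poly_mat A f0 *\<^sub>v v"
    using range[OF Av] by blast
  have yq: "y = poly_mat A ([:0, 1:] ^ k - f0) *\<^sub>v v"
    unfolding y_def f0(2) using A v
    by (simp add: poly_mat_diff poly_mat_power poly_mat_X vec_simps)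
  have "krylov_proj A v (Suc k) ?R"
    unfolding krylov_proj_def
  proof (intro conjI allI impI ballI)
    show "?R \<in> sq" by (intro sq_closed) auto
    fix j assume "j < Suc k"
    then consider "j < k" | "j = k" by linarith
    thus "?R *\<^sub>v (A ^\<^sub>m j *\<^sub>v v) = A ^\<^sub>m j *\<^sub>v v"
    proof cases
      case 1
      have "0 \<cdot>\<^sub>v y = 0\<^sub>v n" using y by (rule zero_smult_vec)
      thus ?thesis using R'[OF Av, of j] w(2)[OF 1] fix_pow[OF 1] Av[of j] by simp
    next
      case 2
      have "R *\<^sub>v (A ^\<^sub>m k *\<^sub>v v) \<in> cv" using Rsq Av by (rule sq_closed(2))
      hence "R *\<^sub>v (A ^\<^sub>m k *\<^sub>v v) + y = A ^\<^sub>m k *\<^sub>v v"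
        unfolding y_def using Av[of k] by (rule vec_add_diff)
      thus ?thesis using R'[OF Av, of k] w(3) 2 by simp
    qed
  next
    fix x :: "'a vec" assume x: "x \<in> cv"
    from range[OF x] obtain f where f: "f = 0 \<or> degree f < k" "R *\<^sub>v x = poly_mat A f *\<^sub>v v" by blast
    let ?f = "f + smult (w \<bullet> x) ([:0, 1:] ^ k - f0)"
    have "?R *\<^sub>v x = poly_mat A ?f *\<^sub>v v"
      unfolding R'[OF x] f(2) unfolding yq using A v by (simp add: poly_mat_add poly_mat_smult vec_simps)
    moreover have "degree ?f \<le> k"
      using f(1) f0(1) by (auto intro!: degree_add_le degree_diff_le degree_smult_le[THEN order_trans] simp: degree_power_eq)
    ultimately show "\<exists>f. (f = 0 \<or> degree f < Suc k) \<and> ?R *\<^sub>v x = poly_mat A f *\<^sub>v v"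
      by (intro exI[of _ ?f]) simp
  qed
  thus ?case by blast
qed

text \<open>
  Among the vectors in the image of \<open>F\<close> choose \<open>v\<close> with annihilator \<open>d\<close> of largest degree \<open>m\<close>. Then
  \<open>d\<close> annihilates the whole image of \<open>F\<close>, so it annihilates every functional that factors through
  \<open>F\<close>. Composing with \<open>F\<close> a functional that separates \<open>A\<^bsup>m-1\<^esup> v\<close> from the lower powers gives \<open>w\<close>.
\<close>

lemma cyclic_pair_exists:
  fixes A F :: "'a::field mat"
  assumes A: "A \<in> sq" and F: "F \<in> sq" and com: "A * F = F * A" and FF: "F * F = F"
    and F0: "F \<noteq> 0\<^sub>m n n"
  shows "\<exists>v w d. cyclic_pair n A v w d \<and> F *\<^sub>v v = v \<and> outer v w * F = outer v w \<and>
    poly_mat A d * F = 0\<^sub>m n n"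
proof -
  \<comment> \<open>Degrees of annihilators are bounded by \<open>n\<close>, so a largest one exists; the zero vector shows that
    there is a candidate.\<close>
  define P where "P = (\<lambda>(v, d). v \<in> cv \<and> F *\<^sub>v v = v \<and> annihilator A v d)"
  have P0: "P (0\<^sub>v n, 1)"
    using A F by (auto simp: P_def vec_simps annihilator_def)
  have bound: "degree (snd vd) < Suc n" if Pvd: "P vd" for vd
  proof -
    obtain v d where vd: "vd = (v, d)" by (cases vd)
    with Pvd have "v \<in> cv" and d: "annihilator A v d" by (auto simp: P_def)
    then obtain e where e: "annihilator A v e" "degree e \<le> n" using annihilator_exists[OF A] by blast
    have "poly_mat A e *\<^sub>v v = 0\<^sub>v n" using annihilatorD(2)[OF e(1), of e] by simp
    hence "d dvd e" using annihilatorD(2)[OF d] by simp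
    hence "degree d \<le> degree e" using annihilatorD(1)[OF e(1)] by (rule dvd_imp_degree_le)
    thus ?thesis using e(2) vd by simp
  qed
  obtain vd where vd: "P vd" "\<And>x. P x \<Longrightarrow> degree (snd x) \<le> degree (snd vd)"
    using ex_has_greatest_nat[of P, OF P0, of "\<lambda>x. degree (snd x)" "Suc n"] bound by blast
  obtain v d0 where "vd = (v, d0)" by (cases vd)
  with vd have v: "v \<in> cv" and Fv: "F *\<^sub>v v = v" and d0: "annihilator A v d0"
    and max: "\<And>x e. x \<in> cv \<Longrightarrow> F *\<^sub>v x = x \<Longrightarrow> annihilator A x e \<Longrightarrow> degree e \<le> degree d0" by (force simp: P_def)+
  have d0F: "poly_mat A d0 * F = 0\<^sub>m n n"
  proof (rule mat_eq_vecI)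
    fix x :: "'a vec" assume x: "x \<in> cv"
    have "F *\<^sub>v (F *\<^sub>v x) = F *\<^sub>v x" using x F FF by (metis vec_simps(1))
    from max_annihilator_kills[OF A F com v Fv d0 max _ this]
    have "poly_mat A d0 *\<^sub>v (F *\<^sub>v x) = 0\<^sub>v n" using F x by (simp add: sq_closed)
    thus "poly_mat A d0 * F *\<^sub>v x = 0\<^sub>m n n *\<^sub>v x" using A F x by (simp add: vec_simps)
  qed (use A F in auto)
  define d where "d = smult (inverse (lead_coeff d0)) d0"
  have nz: "d0 \<noteq> 0" using annihilatorD(1)[OF d0] .
  have d: "annihilator A v d"
    using d0 nz unfolding annihilator_def d_def by (simp add: smult_dvd_iff)
  have monic: "lead_coeff d = 1" using nz by (simp add: d_def)
  have dF: "poly_mat A d * F = 0\<^sub>m n n"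
    unfolding d_def using A F d0F by (simp add: poly_mat_smult sq_simps)
  have deg: "degree d > 0"
  proof (rule ccontr)
    assume "\<not> degree d > 0"
    hence "d = 1" using monic by (metis degree_0_id gr0I lead_coeff_pCons(2) one_pCons)
    with dF F0 A F show False by (simp add: sq_simps)
  qed
  obtain m where m: "degree d = Suc m" using deg by (cases "degree d") auto
  obtain R where "krylov_proj A v m R" using krylov_proj_exists[OF A v d, of m] m by auto
  from separating_functional[OF A v d _ this] m obtain w0 where
    w0: "w0 \<in> cv" "\<And>j. j < m \<Longrightarrow> w0 \<bullet> (A ^\<^sub>m j *\<^sub>v v) = 0" "w0 \<bullet> (A ^\<^sub>m m *\<^sub>v v) = 1" by auto
  define w where "w = transpose_mat F *\<^sub>v w0"
  have w: "w \<in> cv" unfolding w_def using F w0(1) by (intro sq_closed) auto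
  have wx: "w \<bullet> x = w0 \<bullet> (F *\<^sub>v x)" if "x \<in> cv" for x
    unfolding w_def using transpose_vec_mult_scalar[OF F that w0(1)] by simp
  have FAv: "F *\<^sub>v (A ^\<^sub>m j *\<^sub>v v) = A ^\<^sub>m j *\<^sub>v v" for j
    using pow_commute_vec[OF A F com v] Fv by simp
  have Av: "A ^\<^sub>m j *\<^sub>v v \<in> cv" for j using A v by (intro sq_closed) auto
  have FF_vec: "F *\<^sub>v (F *\<^sub>v x) = F *\<^sub>v x" if "x \<in> cv" for x
    using that F FF by (metis vec_simps(1))
  have "cyclic_pair n A v w d"
  proof
    show "poly_mat A d *\<^sub>v v = 0\<^sub>v n" using annihilatorD(2)[OF d, of d] by simp
    show "w \<bullet> (A ^\<^sub>m i *\<^sub>v v) = (if Suc i = degree d then 1 else 0)" if "i < degree d" for i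
      using that w0(2)[of i] w0(3) m wx[OF Av, of i] FAv[of i] by (cases "i = m") auto
    show "outer v w * poly_mat A d = 0\<^sub>m n n"
    proof (rule mat_eq_vecI)
      fix x :: "'a vec" assume x: "x \<in> cv"
      have "F * poly_mat A d = 0\<^sub>m n n" using poly_mat_commute[OF A F com, of d] dF by simp
      hence "F *\<^sub>v (poly_mat A d *\<^sub>v x) = 0\<^sub>v n" using A F x by (metis poly_mat_closed vec_simps(1) vec_simps(8))
      hence "w \<bullet> (poly_mat A d *\<^sub>v x) = 0" using wx[of "poly_mat A d *\<^sub>v x"] A x w0(1) by (simp add: sq_closed)
      thus "outer v w * poly_mat A d *\<^sub>v x = 0\<^sub>m n n *\<^sub>v x"
        using A x v w by (simp add: vec_simps outer_mult_vec zero_smult_vec)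
    qed (use A in auto)
  qed (fact A v w monic deg)+
  moreover have "outer v w * F = outer v w"
    using F v w by (intro mat_eq_vecI) (auto simp: vec_simps outer_mult_vec wx FF_vec sq_closed)
  ultimately show ?thesis using Fv dF by blast
qed

text \<open>
  Applied to the projection of a cyclic pair inside the image of \<open>F\<close>, this shows that the projection
  vanishes on the complementary summand.
\<close>

lemma bezoutian_mult_right:
  assumes Z: "Z \<in> sq" and u: "u \<in> sq" and A: "A \<in> sq" and F: "F \<in> sq"
    and com: "A * F = F * A" and uF: "u * F = u"
  shows "bezoutian Z u A p * F = bezoutian Z u A p"
proof (induction p)
  case (pCons a p)
  have "bezoutian Z u A p * A * F = bezoutian Z u A p * F * A"
    using assms by (simp add: sq_simps bezoutian_closed)
  thus ?case using assms pCons by (simp add: bezoutian_pCons sq_simps bezoutian_closed)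
qed (use F in \<open>simp add: sq_simps\<close>)

end

section \<open>Extension of scalars to the algebraic closure\<close>

interpretation to_ac_hom: field_hom "to_ac :: 'a::field \<Rightarrow> 'a alg_closure"
  by unfold_locales auto

interpretation map_poly_to_ac: map_poly_idom_hom "to_ac :: 'a::field \<Rightarrow> 'a alg_closure" ..

context square
begin

lemma mat_ac_add:
  "A \<in> sq \<Longrightarrow> B \<in> sq \<Longrightarrow> mat_ac (A + B) = mat_ac A + mat_ac B"
  by (intro eq_matI) auto

lemma mat_ac_diff:
  "A \<in> sq \<Longrightarrow> B \<in> sq \<Longrightarrow> mat_ac (A - B) = mat_ac A - mat_ac B"
  by (intro eq_matI) auto

lemma mat_ac_smult: "mat_ac (a \<cdot>\<^sub>m A) = to_ac a \<cdot>\<^sub>m mat_ac A"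
  by (intro eq_matI) auto

lemma mat_ac_mult:
  "A \<in> sq \<Longrightarrow> B \<in> sq \<Longrightarrow> mat_ac (A * B) = mat_ac A * mat_ac B"
  by (rule to_ac_hom.mat_hom_mult)

lemma mat_ac_zero: "mat_ac (0\<^sub>m n n) = 0\<^sub>m n n"
  by (intro eq_matI) auto

lemma mat_ac_poly_mat:
  "A \<in> sq \<Longrightarrow> mat_ac (poly_mat A p) = poly_mat (mat_ac A) (map_poly to_ac p)"
  by (induction p)
    (simp_all add: poly_mat_pCons mat_ac_add mat_ac_smult mat_ac_mult mat_ac_zero
      to_ac_hom.mat_hom_one to_ac_hom.map_poly_pCons_hom)

lemma mat_ac_bezoutian:
  assumes "Z \<in> sq" "u \<in> sq" "Y \<in> sq"
  shows "mat_ac (bezoutian Z u Y p) = bezoutian (mat_ac Z) (mat_ac u) (mat_ac Y) (map_poly to_ac p)"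
  using assms
  by (induction p)
    (simp_all add: bezoutian_pCons bezoutian_closed mat_ac_poly_mat mat_ac_add mat_ac_mult mat_ac_zero
      to_ac_hom.map_poly_pCons_hom)

lemma mat_ac_outer:
  "v \<in> cv \<Longrightarrow> w \<in> cv \<Longrightarrow> mat_ac (outer v w) = outer (map_vec to_ac v) (map_vec to_ac w)"
  by (intro eq_matI) (auto simp: outer_def)

end

lemma scalar_prod_ac:
  assumes "dim_vec x = dim_vec y"
  shows "to_ac (x \<bullet> y) = map_vec to_ac x \<bullet> map_vec to_ac y"
  using assms by (simp add: scalar_prod_def to_ac_sum)

text \<open>
  All conditions are equations between matrices, vectors and coefficients, hence they are preserved by
  the embedding into the algebraic closure.
\<close>

lemma (in cyclic_pair) cyclic_pair_ac:
  "cyclic_pair n (mat_ac A) (map_vec to_ac v) (map_vec to_ac w) (map_poly to_ac d)"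
proof
  show "lead_coeff (map_poly to_ac d) = 1" using monic by simp
  show "degree (map_poly to_ac d) > 0" using deg by simp
  show "poly_mat (mat_ac A) (map_poly to_ac d) *\<^sub>v map_vec to_ac v = 0\<^sub>v n"
    using to_ac_hom.mult_mat_vec_hom[of "poly_mat A d" n n v] d_v
    by (simp add: mat_ac_poly_mat to_ac_hom.vec_hom_zero)
  show "outer (map_vec to_ac v) (map_vec to_ac w) * poly_mat (mat_ac A) (map_poly to_ac d) = 0\<^sub>m n n"
    using arg_cong[OF w_d, of mat_ac]
    by (simp add: mat_ac_mult mat_ac_poly_mat mat_ac_outer mat_ac_zero)
  fix i assume "i < degree (map_poly to_ac d)"
  hence i: "i < degree d" by simp
  have "map_vec to_ac w \<bullet> (mat_ac A ^\<^sub>m i *\<^sub>v map_vec to_ac v) = to_ac (w \<bullet> (A ^\<^sub>m i *\<^sub>v v))"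
    using to_ac_hom.mult_mat_vec_hom[of "A ^\<^sub>m i" n n v] scalar_prod_ac[of w "A ^\<^sub>m i *\<^sub>v v"]
    by (simp add: to_ac_hom.mat_hom_pow[OF A] sq_closed carrier_matD[OF A] carrier_vecD[OF w])
  thus "map_vec to_ac w \<bullet> (mat_ac A ^\<^sub>m i *\<^sub>v map_vec to_ac v) =
    (if Suc i = degree (map_poly to_ac d) then 1 else 0)"
    using dual[OF i] by simp
qed auto

lemma (in cyclic_pair) mat_ac_proj:
  "mat_ac proj = cyclic_pair.proj n (mat_ac A) (map_vec to_ac v) (map_vec to_ac w) (map_poly to_ac d)"
  unfolding cyclic_pair.proj_def[OF cyclic_pair_ac] proj_def
  by (simp add: mat_ac_bezoutian mat_ac_outer)

section \<open>Divisibility by a reflected polynomial\<close>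

lemma order_linear_eq: "order e [:-a, 1:] = (if e = a then 1 else (0::nat))"
  for a e :: "'a::field"
  using order_power_n_n[of a 1] by (auto intro: order_0I)

text \<open>
  The substitution \<open>t \<mapsto> c - t\<close> turns the factor \<open>t - (c - e)\<close> into \<open>-(t - e)\<close>.
\<close>

lemma order_reflected:
  fixes p :: "'a::field poly"
  assumes p: "p \<noteq> 0"
  shows "order e (p \<circ>\<^sub>p [:c, -1:]) = order (c - e) p"
proof -
  obtain q where q: "p = [:- (c - e), 1:] ^ order (c - e) p * q" "\<not> [:- (c - e), 1:] dvd q"
    using order_decomp[OF p] by blast
  define m where "m = order (c - e) p"
  have "[:- (c - e), 1:] \<circ>\<^sub>p [:c, -1:] = - [:-e, 1:]" by (simp add: pcompose_pCons)
  hence eq: "p \<circ>\<^sub>p [:c, -1:] = (- [:-e, 1:]) ^ m * (q \<circ>\<^sub>p [:c, -1:])"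
    by (subst q(1)) (simp only: pcompose_mult pcompose_hom.hom_power m_def)
  have nz: "poly (q \<circ>\<^sub>p [:c, -1:]) e \<noteq> 0"
    using q(2) by (simp add: poly_pcompose poly_eq_0_iff_dvd)
  hence "q \<circ>\<^sub>p [:c, -1:] \<noteq> 0" by auto
  moreover have "(- [:-e, 1:]) ^ m = smult ((-1) ^ m) ([:-e, 1:] ^ m)"
    by (metis smult_power smult_1_left smult_minus_left)
  ultimately show ?thesis
    unfolding eq using order_0I[OF nz]
    by (subst order_mult) (simp_all add: order_smult order_power_n_n m_def)
qed

lemma alg_closed_dvd_by_order:
  fixes p q :: "'a::alg_closed_field poly"
  assumes "p \<noteq> 0" "q \<noteq> 0" "\<And>e. order e p \<le> order e q"
  shows "p dvd q"
  using assms
proof (induction "degree p" arbitrary: p q)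
  case 0
  thus ?case by (metis is_unit_iff_degree unit_imp_dvd)
next
  case (Suc m)
  then obtain a where a: "poly p a = 0" using alg_closed_imp_poly_has_root[of p] by auto
  hence "order a q \<noteq> 0" using Suc.prems(1) Suc.prems(3)[of a] by (auto simp: order_root)
  hence "poly q a = 0" by (simp add: order_root)
  with a obtain p' q' where pq: "p = [:-a, 1:] * p'" "q = [:-a, 1:] * q'"
    unfolding poly_eq_0_iff_dvd by (elim dvdE)
  hence nz: "p' \<noteq> 0" "q' \<noteq> 0" using Suc.prems by auto
  have "degree p = Suc (degree p')" unfolding pq(1) using nz by (subst degree_mult_eq) auto
  moreover have "order e p' \<le> order e q'" for e
    using Suc.prems(3)[of e] order_mult[OF Suc.prems(1)[unfolded pq(1)], of e]
      order_mult[OF Suc.prems(2)[unfolded pq(2)], of e]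
    unfolding pq(1,2) by linarith
  ultimately have "p' dvd q'" using Suc.hyps(1)[of p' q'] Suc.hyps(2) nz by simp
  thus ?case unfolding pq by (rule mult_dvd_mono[OF dvd_refl])
qed

text \<open>
  The order of \<open>g(t) d(c - t)\<close> at \<open>e\<close> is that of \<open>d\<close> at \<open>c - e\<close>, plus the order of \<open>g\<close>. The factor
  \<open>g = t\<close> makes up for a possible deficit at \<open>0\<close>, the factor \<open>g = c - t\<close> for one at \<open>c\<close>. Divisibility
  is tested in the algebraic closure, where it amounts to a comparison of orders.
\<close>

lemma skew_divisor_exists:
  fixes d :: "'a::field poly" and c :: 'a
  defines "ord \<equiv> \<lambda>e. order e (map_poly to_ac d)"
  assumes d: "d \<noteq> 0"
    and sym: "\<And>e. e \<notin> {0, to_ac c} \<Longrightarrow> ord e = ord (to_ac c - e)"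
    and near: "ord (to_ac c) \<le> Suc (ord 0)" "ord 0 \<le> Suc (ord (to_ac c))"
  shows "\<exists>g. g * (g \<circ>\<^sub>p [:c, -1:]) = [:0, 1:] * [:c, -1:] \<and> d dvd g * (d \<circ>\<^sub>p [:c, -1:])"
proof -
  let ?r = "[:c, -1:]" and ?c = "to_ac c"
  have dac: "map_poly to_ac d \<noteq> 0" using d by simp
  have refl_nz: "d \<circ>\<^sub>p ?r \<noteq> 0" using d by (simp add: pcompose_eq_0_iff)
  have lift: "d dvd g * (d \<circ>\<^sub>p ?r)"
    if g: "g \<noteq> 0" and le: "\<And>e. ord e \<le> order e (map_poly to_ac g) + ord (?c - e)" for g
  proof (rule to_ac_hom.dvd_map_poly_hom_imp_dvd, rule alg_closed_dvd_by_order)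
    have eq: "map_poly to_ac (g * (d \<circ>\<^sub>p ?r)) = map_poly to_ac g * (map_poly to_ac d \<circ>\<^sub>p [:?c, -1:])"
      by (simp add: to_ac_hom.map_poly_pcompose map_poly_to_ac.hom_mult)
    fix e
    have "g * (d \<circ>\<^sub>p ?r) \<noteq> 0" using g refl_nz by simp
    thus nz0: "map_poly to_ac (g * (d \<circ>\<^sub>p ?r)) \<noteq> 0" by simp
    note nz = nz0[unfolded eq]
    show "order e (map_poly to_ac d) \<le> order e (map_poly to_ac (g * (d \<circ>\<^sub>p ?r)))"
      unfolding eq order_mult[OF nz] order_reflected[OF dac] using le[of e] by (simp add: ord_def)
  qed (rule dac)
  show ?thesis
  proof (cases "ord ?c \<le> ord 0")
    case True
    have "order e (map_poly to_ac [:0, 1:]) = (if e = 0 then 1 else 0)" for e :: "'a alg_closure"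
      using order_linear_eq[of e 0] by simp
    hence "ord e \<le> order e (map_poly to_ac [:0, 1:]) + ord (?c - e)" for e
      using sym[of e] near True by (cases "e = 0"; cases "e = ?c") simp_all
    hence "d dvd [:0, 1:] * (d \<circ>\<^sub>p ?r)" by (intro lift) auto
    moreover have "[:0, 1:] * ([:0, 1:] \<circ>\<^sub>p ?r) = [:0, 1:] * ?r" by (simp add: pcompose_pCons)
    ultimately show ?thesis by blast
  next
    case False
    have "map_poly to_ac ?r = - [:- ?c, 1:]" by simp
    hence "order e (map_poly to_ac ?r) = (if e = ?c then 1 else 0)" for e
      by (simp only: order_uminus order_linear_eq)
    hence "ord e \<le> order e (map_poly to_ac ?r) + ord (?c - e)" for e
      using sym[of e] near False by (cases "e = 0"; cases "e = ?c") simp_all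
    hence "d dvd ?r * (d \<circ>\<^sub>p ?r)" by (intro lift) auto
    moreover have "?r * (?r \<circ>\<^sub>p ?r) = [:0, 1:] * ?r" by (simp add: pcompose_pCons)
    ultimately show ?thesis by blast
  qed
qed

section \<open>Composites and skew roots\<close>

context square
begin

lemma poly_mat_reflect:
  "A \<in> sq \<Longrightarrow> poly_mat A [:c, -1:] = c \<cdot>\<^sub>m 1\<^sub>m n - A"
  by (simp add: poly_mat_linear)
    (rule sq_eqI; simp add: sq_index del: index_one_mat)

text \<open>
  The equations for \<open>S\<close> are equivalent to \<open>(A + S)\<^sup>2 = 2\<alpha>(A + S)\<close> together with
  \<open>(A - S)\<^sup>2 = 2\<alpha>(A - S)\<close>. Both directions are direct computations; division by \<open>2\<alpha>\<close> is where the
  characteristic enters.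
\<close>

lemma mat_composite_iff_skew_root:
  fixes A :: "'a::field mat"
  assumes A: "A \<in> sq" and two: "(2::'a) \<noteq> 0" and a: "\<alpha> \<noteq> 0"
  shows "mat_composite n \<alpha> \<alpha> A \<longleftrightarrow>
    (\<exists>S\<in>sq. S * A = poly_mat A [:2 * \<alpha>, -1:] * S \<and> S * S = A * poly_mat A [:2 * \<alpha>, -1:])"
proof
  assume "mat_composite n \<alpha> \<alpha> A"
  then obtain P Q where P: "P \<in> sq" "P * P = P" and Q: "Q \<in> sq" "Q * Q = Q"
    and AP: "A = \<alpha> \<cdot>\<^sub>m P + \<alpha> \<cdot>\<^sub>m Q" by (auto simp: mat_composite_def)
  have PPZ: "P * (P * Z) = P * Z" "Q * (Q * Z) = Q * Z" if "Z \<in> sq" for Z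
    using that P Q by (metis sq_simps(1))+
  let ?S = "\<alpha> \<cdot>\<^sub>m (P - Q)"
  show "\<exists>S\<in>sq. S * A = poly_mat A [:2 * \<alpha>, -1:] * S \<and> S * S = A * poly_mat A [:2 * \<alpha>, -1:]"
  proof (intro bexI[of _ ?S] conjI)
    show "?S * A = poly_mat A [:2 * \<alpha>, -1:] * ?S"
      unfolding poly_mat_reflect[OF A] unfolding AP using P Q
      by (simp add: sq_simps PPZ) (rule sq_eqI; simp add: sq_index algebra_simps del: index_mult_mat(1))
    show "?S * ?S = A * poly_mat A [:2 * \<alpha>, -1:]"
      unfolding poly_mat_reflect[OF A] unfolding AP using P Q
      by (simp add: sq_simps PPZ) (rule sq_eqI; simp add: sq_index algebra_simps del: index_mult_mat(1))
  qed (use P Q in auto)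
next
  assume "\<exists>S\<in>sq. S * A = poly_mat A [:2 * \<alpha>, -1:] * S \<and> S * S = A * poly_mat A [:2 * \<alpha>, -1:]"
  then obtain S where S: "S \<in> sq" and SA: "S * A = (2 * \<alpha>) \<cdot>\<^sub>m S - A * S"
    and SS: "S * S = (2 * \<alpha>) \<cdot>\<^sub>m A - A * A"
    using A by (auto simp: poly_mat_reflect sq_simps)
  let ?b = "inverse (2 * \<alpha>)"
  have idem: "(?b \<cdot>\<^sub>m T) * (?b \<cdot>\<^sub>m T) = ?b \<cdot>\<^sub>m T" if T: "T \<in> sq" "T * T = (2 * \<alpha>) \<cdot>\<^sub>m T" for T
  proof -
    have "(?b \<cdot>\<^sub>m T) * (?b \<cdot>\<^sub>m T) = ?b \<cdot>\<^sub>m (?b \<cdot>\<^sub>m ((2 * \<alpha>) \<cdot>\<^sub>m T))" using T by (simp add: sq_simps)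
    also have "\<dots> = ?b \<cdot>\<^sub>m T" using T(1) two a
      by (intro sq_eqI) (simp_all add: sq_index)
    finally show ?thesis .
  qed
  have sqr: "(A + S) * (A + S) = (2 * \<alpha>) \<cdot>\<^sub>m (A + S)" "(A - S) * (A - S) = (2 * \<alpha>) \<cdot>\<^sub>m (A - S)"
    using A S
    by (simp_all add: sq_simps SA SS)
      (rule sq_eqI; simp add: sq_index algebra_simps del: index_mult_mat(1))+
  have "(?b \<cdot>\<^sub>m (A + S)) * (?b \<cdot>\<^sub>m (A + S)) = ?b \<cdot>\<^sub>m (A + S)"
    "(?b \<cdot>\<^sub>m (A - S)) * (?b \<cdot>\<^sub>m (A - S)) = ?b \<cdot>\<^sub>m (A - S)"
    by (rule idem[OF _ sqr(1)], use A S in simp) (rule idem[OF _ sqr(2)], use A S in simp)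
  moreover have "A = \<alpha> \<cdot>\<^sub>m (?b \<cdot>\<^sub>m (A + S)) + \<alpha> \<cdot>\<^sub>m (?b \<cdot>\<^sub>m (A - S))"
    using A S two a by (intro sq_eqI) (simp_all add: sq_index field_simps del: index_mult_mat(1))
  ultimately show "mat_composite n \<alpha> \<alpha> A"
    unfolding mat_composite_def using A S
    by (intro bexI[of _ "?b \<cdot>\<^sub>m (A + S)"] bexI[of _ "?b \<cdot>\<^sub>m (A - S)"]) auto
qed

end

section \<open>Jordan normal forms over algebraically closed fields\<close>

text \<open>
  The matrix \<open>W = 1 + (v - e\<^sub>0) w\<close> maps \<open>e\<^sub>0\<close> to \<open>v\<close> if \<open>w e\<^sub>0 = 1\<close>. As a rank one perturbation of the
  identity it is invertible if \<open>w v \<noteq> 0\<close>, with inverse \<open>1 - (v - e\<^sub>0) w / (w v)\<close>. Both properties can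
  be had with a coordinate or a sum of two coordinates as \<open>w\<close>.
\<close>

lemma invertible_with_first_col:
  fixes v :: "'a::field vec"
  assumes v: "v \<in> carrier_vec n" and v0: "v \<noteq> 0\<^sub>v n" and n: "n > 0"
  shows "\<exists>W\<in>carrier_mat n n. \<exists>W'\<in>carrier_mat n n.
    W * W' = 1\<^sub>m n \<and> W' * W = 1\<^sub>m n \<and> W *\<^sub>v unit_vec n 0 = v"
proof -
  interpret square n .
  let ?e = "unit_vec n :: nat \<Rightarrow> 'a vec"
  have "\<exists>i<n. vec_index v i \<noteq> 0"
    using v v0 by (metis carrier_vecD eq_vecI index_zero_vec)
  then obtain i where i: "i < n" "vec_index v i \<noteq> 0" by blast
  obtain w where w: "w \<in> cv" "w \<bullet> ?e 0 = 1" "w \<bullet> v \<noteq> 0"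
  proof (cases "vec_index v 0 = 0")
    case False
    thus ?thesis using n v by (intro that[of "?e 0"]) auto
  next
    case True
    hence "i \<noteq> 0" using i by metis
    have "(?e 0 + ?e i) \<bullet> x = vec_index x 0 + vec_index x i" if "x \<in> cv" for x
      using that n i by (simp add: add_scalar_prod_distrib[of _ n])
    thus ?thesis using n v i True \<open>i \<noteq> 0\<close> by (intro that[of "?e 0 + ?e i"]) auto
  qed
  let ?y = "v - ?e 0"
  have y: "?y \<in> cv" using v by simp
  have wy: "w \<bullet> ?y = w \<bullet> v - 1" using w v by (simp add: scalar_prod_minus_distrib[of _ n])
  let ?U = "outer ?y w" and ?a = "inverse (w \<bullet> v)"
  let ?W = "1\<^sub>m n + ?U" and ?W' = "1\<^sub>m n - ?a \<cdot>\<^sub>m ?U"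
  have UU: "?U * ?U = (w \<bullet> v - 1) \<cdot>\<^sub>m ?U"
    using w(1) y
    by (intro mat_eq_vecI) (auto simp: vec_simps outer_mult_vec wy[symmetric] smult_smult_assoc mult.commute)
  have eq0: "1\<^sub>m n + (?U - ?a \<cdot>\<^sub>m ?U - ?a \<cdot>\<^sub>m ((w \<bullet> v - 1) \<cdot>\<^sub>m ?U)) = 1\<^sub>m n"
    using w(3) by (intro sq_eqI) (auto simp: sq_index field_simps simp del: index_one_mat)
  have "?W * ?W' = 1\<^sub>m n + (?U - ?a \<cdot>\<^sub>m ?U - ?a \<cdot>\<^sub>m ((w \<bullet> v - 1) \<cdot>\<^sub>m ?U))"
    by (simp add: sq_simps UU)
      (rule sq_eqI; simp add: sq_index algebra_simps del: index_mult_mat(1) index_one_mat)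
  moreover have "?W' * ?W = 1\<^sub>m n + (?U - ?a \<cdot>\<^sub>m ?U - ?a \<cdot>\<^sub>m ((w \<bullet> v - 1) \<cdot>\<^sub>m ?U))"
    by (simp add: sq_simps UU)
      (rule sq_eqI; simp add: sq_index algebra_simps del: index_mult_mat(1) index_one_mat)
  moreover have "?W *\<^sub>v ?e 0 = v"
    using w y vec_add_diff[of "?e 0" v] v by (simp add: vec_simps outer_mult_vec)
  ultimately show ?thesis unfolding eq0
    by (intro bexI[of _ ?W] bexI[of _ ?W']) auto
qed

text \<open>
  An eigenvector is made the first basis vector, and the induction hypothesis is applied to the
  remaining diagonal block.
\<close>

lemma alg_closed_triangular:
  fixes A :: "'a::alg_closed_field mat"
  assumes "A \<in> carrier_mat n n"
  shows "\<exists>B\<in>carrier_mat n n. upper_triangular B \<and> (\<exists>P Q. similar_mat_wit A B P Q)"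
  using assms
proof (induction n arbitrary: A)
  case 0
  thus ?case by (intro bexI[of _ A] conjI) (auto intro: similar_mat_wit_refl)
next
  case (Suc m)
  let ?n = "Suc m"
  note A = Suc.prems
  interpret square ?n .
  have "degree (char_poly A) > 0" using degree_monic_char_poly[OF A] by simp
  then obtain e where "poly (char_poly A) e = 0" using alg_closed_imp_poly_has_root by blast
  hence "eigenvalue A e" using eigenvalue_root_char_poly[OF A] by simp
  then obtain v where v: "v \<in> cv" "v \<noteq> 0\<^sub>v ?n" and Av: "A *\<^sub>v v = e \<cdot>\<^sub>v v"
    using A by (auto simp: eigenvalue_def eigenvector_def)
  obtain W W' where W: "W \<in> sq" and W': "W' \<in> sq" and inv: "W * W' = 1\<^sub>m ?n" "W' * W = 1\<^sub>m ?n"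
    and W0: "W *\<^sub>v unit_vec ?n 0 = v"
    using invertible_with_first_col[OF v] by auto
  define B where "B = W' * A * W"
  have B: "B \<in> sq" using W W' A by (simp add: B_def)
  have "W * B * W' = (W * W') * A * (W * W')" using W W' A by (simp add: B_def sq_simps)
  hence "A = W * B * W'" using A by (simp add: inv sq_simps)
  hence wit1: "similar_mat_wit A B W W'"
    by (intro similar_mat_witI[OF inv]) (use A B W W' in auto)
  have "W' *\<^sub>v v = unit_vec ?n 0"
    using W W' inv(2) W0 by (metis unit_vec_carrier vec_simps(1) vec_simps(9))
  hence Be: "B *\<^sub>v unit_vec ?n 0 = e \<cdot>\<^sub>v unit_vec ?n 0"
    using W W' A v by (simp add: B_def vec_simps W0 Av)
  hence col0: "B $$ (i, 0) = e * (if i = 0 then 1 else 0)" if "i < ?n" for i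
  proof -
    have "B $$ (i, 0) = vec_index (B *\<^sub>v unit_vec ?n 0) i" using that B by simp
    also have "\<dots> = e * (if i = 0 then 1 else 0)" unfolding Be using that by simp
    finally show ?thesis .
  qed
  obtain B1 B2 B3 B4 where split: "split_block B 1 1 = (B1, B2, B3, B4)"
    by (cases "split_block B 1 1") auto
  have dims: "dim_row B = 1 + m" "dim_col B = 1 + m" using B by auto
  from split_block[OF split dims]
  have Bs: "B1 \<in> carrier_mat 1 1" "B2 \<in> carrier_mat 1 m" "B3 \<in> carrier_mat m 1" "B4 \<in> carrier_mat m m"
    and Bblock: "B = four_block_mat B1 B2 B3 B4" by auto
  have B3: "B3 = 0\<^sub>m m 1"
  proof (rule eq_matI)
    fix i j assume "i < dim_row (0\<^sub>m m 1 :: 'a mat)" "j < dim_col (0\<^sub>m m 1 :: 'a mat)"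
    hence ij: "i < m" "j = 0" by auto
    have "B $$ (Suc i, 0) = B3 $$ (i, 0)" using Bs ij by (subst Bblock) auto
    thus "B3 $$ (i, j) = 0\<^sub>m m 1 $$ (i, j)" using col0[of "Suc i"] ij by simp
  qed (use Bs in auto)
  obtain C P Q where C: "C \<in> carrier_mat m m" "upper_triangular C"
    and wit: "similar_mat_wit B4 C P Q" using Suc.IH[OF Bs(4)] by blast
  from similar_mat_witD2[OF Bs(4) wit] have PQ: "P \<in> carrier_mat m m" "Q \<in> carrier_mat m m"
    "P * Q = 1\<^sub>m m" by auto
  let ?C = "four_block_mat B1 (B2 * P) (0\<^sub>m m 1) C"
  have "similar_mat_wit (four_block_mat B1 B2 B3 B4) ?C
    (four_block_mat (1\<^sub>m 1) (0\<^sub>m 1 m) (0\<^sub>m m 1) P) (four_block_mat (1\<^sub>m 1) (0\<^sub>m 1 m) (0\<^sub>m m 1) Q)"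
  proof (rule similar_mat_wit_four_block[OF similar_mat_wit_refl[OF Bs(1)] wit _ _ Bs(1) Bs(4)])
    have "B2 * P * Q = B2 * (P * Q)" using Bs PQ by (intro assoc_mult_mat)
    thus "B2 = 1\<^sub>m 1 * (B2 * P) * Q" using Bs PQ by simp
    show "B3 = P * 0\<^sub>m m 1 * 1\<^sub>m 1" unfolding B3 using PQ by simp
  qed (use Bs PQ in auto)
  from similar_mat_wit_trans[OF wit1 this[folded Bblock]]
  have "\<exists>P Q. similar_mat_wit A ?C P Q" by blast
  moreover have "upper_triangular ?C"
    using Bs by (intro upper_triangular_four_block[OF _ C(1) _ C(2)]) (auto simp: upper_triangular_def)
  moreover have "?C \<in> sq" using Bs C by auto
  ultimately show ?case by blast
qed

lemma jordan_nf_alg_closed: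
  fixes A :: "'a::alg_closed_field mat"
  assumes A: "A \<in> carrier_mat n n"
  shows "\<exists>bs. jordan_nf A bs"
proof -
  obtain B P Q where B: "B \<in> carrier_mat n n" "upper_triangular B" and "similar_mat_wit A B P Q"
    using alg_closed_triangular[OF A] by blast
  hence "similar_mat A B" by (auto simp: similar_mat_def)
  with triangular_to_jnf_vector[OF B] show ?thesis
    unfolding jordan_nf_def using similar_mat_trans by blast
qed

section \<open>Block numbers of a matrix with a skew root\<close>

locale skew_root = square +
  fixes A S :: "'a::field mat" and c :: 'a
  assumes A [simp]: "A \<in> sq" and S [simp]: "S \<in> sq"
    and SA: "S * A = poly_mat A [:c, -1:] * S" and SS: "S * S = A * poly_mat A [:c, -1:]"
begin

abbreviation "U e \<equiv> char_matrix A e"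

lemma S_U: "S * U e = - 1 \<cdot>\<^sub>m (U (c - e) * S)"
proof -
  have "poly_mat (poly_mat A [:c, -1:]) [:-e, 1:] * S = S * poly_mat A [:-e, 1:]"
    by (rule poly_mat_intertwine) (simp_all add: SA)
  moreover have "poly_mat (poly_mat A [:c, -1:]) [:-e, 1:] = - 1 \<cdot>\<^sub>m U (c - e)"
    by (subst poly_mat_pcompose[symmetric])
      (simp_all add: pcompose_pCons char_matrix_poly_mat flip: poly_mat_smult)
  ultimately show ?thesis by (simp add: char_matrix_poly_mat sq_simps)
qed

lemma S_U_vec: "x \<in> cv \<Longrightarrow> S *\<^sub>v (U e *\<^sub>v x) = - 1 \<cdot>\<^sub>v (U (c - e) *\<^sub>v (S *\<^sub>v x))"
  using arg_cong[OF S_U[of e], of "\<lambda>M. M *\<^sub>v x"] by (simp add: vec_simps)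

lemma S_U_pow: "x \<in> cv \<Longrightarrow> S *\<^sub>v (U e ^\<^sub>m k *\<^sub>v x) = (- 1) ^ k \<cdot>\<^sub>v (U (c - e) ^\<^sub>m k *\<^sub>v (S *\<^sub>v x))"
proof (induction k arbitrary: x)
  case (Suc k)
  have U: "U e \<in> sq" "U (c - e) \<in> sq" by simp_all
  have Ux: "U e *\<^sub>v x \<in> cv" and Sx: "S *\<^sub>v x \<in> cv" using Suc.prems U by (auto simp: sq_closed)
  have "S *\<^sub>v (U e ^\<^sub>m Suc k *\<^sub>v x) = (- 1) ^ k \<cdot>\<^sub>v (U (c - e) ^\<^sub>m k *\<^sub>v (S *\<^sub>v (U e *\<^sub>v x)))"
    unfolding pow_mat_Suc_vec(2)[OF U(1) Suc.prems] by (rule Suc.IH[OF Ux])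
  also have "\<dots> = (- 1) ^ Suc k \<cdot>\<^sub>v (U (c - e) ^\<^sub>m Suc k *\<^sub>v (S *\<^sub>v x))"
    unfolding S_U_vec[OF Suc.prems] pow_mat_Suc_vec(2)[OF U(2) Sx]
    using Sx by (simp add: vec_simps sq_closed smult_smult_assoc)
  finally show ?case .
qed (simp add: sq_closed vec_simps carrier_matD[OF char_matrix_closed[OF A]])

lemma SS_eigen:
  assumes "y \<in> cv" "U e *\<^sub>v y = 0\<^sub>v n"
  shows "S *\<^sub>v (S *\<^sub>v y) = (e * (c - e)) \<cdot>\<^sub>v y"
proof -
  have "S *\<^sub>v (S *\<^sub>v y) = (S * S) *\<^sub>v y" using assms by (simp add: vec_simps)
  also have "S * S = poly_mat A ([:0, 1:] * [:c, -1:])" by (simp only: SS poly_mat_mult A poly_mat_X)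
  also have "\<dots> *\<^sub>v y = (e * (c - e)) \<cdot>\<^sub>v y" using poly_mat_eigen[OF A assms] by simp
  finally show ?thesis .
qed

abbreviation "W e k \<equiv> deep_ker n (U e) k (1\<^sub>m n)"

lemma vec_subspace_W: "vec_subspace n (W e k)"
  by (rule vec_subspace_deep_ker) auto

lemma W_iff: "y \<in> W e k \<longleftrightarrow> y \<in> cv \<and> U e *\<^sub>v y = 0\<^sub>v n \<and> (\<exists>x\<in>cv. y = U e ^\<^sub>m k *\<^sub>v x)"
  unfolding deep_ker_def by auto

text \<open>
  Moving \<open>S\<close> past \<open>A - e\<close> yields \<open>-(A - (c - e))\<close>, so eigenvectors for \<open>e\<close> go to eigenvectors for
  \<open>c - e\<close>, and the image of a power goes to the image of the same power.
\<close>

lemma S_W: "y \<in> W e k \<Longrightarrow> S *\<^sub>v y \<in> W (c - e) k"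
proof -
  assume "y \<in> W e k"
  then obtain x where y: "y \<in> cv" "U e *\<^sub>v y = 0\<^sub>v n" and x: "x \<in> cv" "y = U e ^\<^sub>m k *\<^sub>v x"
    by (auto simp: W_iff)
  have "- 1 \<cdot>\<^sub>v (U (c - e) *\<^sub>v (S *\<^sub>v y)) = 0\<^sub>v n"
    using S_U_vec[OF y(1), of e] y(2) by (simp add: vec_simps)
  hence "- 1 \<cdot>\<^sub>v (- 1 \<cdot>\<^sub>v (U (c - e) *\<^sub>v (S *\<^sub>v y))) = - 1 \<cdot>\<^sub>v 0\<^sub>v n" by simp
  hence "U (c - e) *\<^sub>v (S *\<^sub>v y) = 0\<^sub>v n"
    by (simp add: smult_smult_assoc zero_smult_vec)
  moreover have "S *\<^sub>v y = U (c - e) ^\<^sub>m k *\<^sub>v ((- 1) ^ k \<cdot>\<^sub>v (S *\<^sub>v x))"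
    using S_U_pow[OF x(1), of e k] x by (simp add: vec_simps sq_closed)
  moreover have "(- 1) ^ k \<cdot>\<^sub>v (S *\<^sub>v x) \<in> cv" using x(1) by (simp add: sq_closed)
  ultimately show ?thesis using y unfolding W_iff by (auto simp: sq_closed)
qed

text \<open>
  Here \<open>S\<^sup>2\<close> acts on \<open>W e k\<close> as the nonzero scalar \<open>e (c - e)\<close>, so \<open>S\<close> is injective on it.
\<close>

lemma dim_sub_W_reflect:
  assumes "e \<noteq> 0" "e \<noteq> c"
  shows "dim_sub n (W e k) \<le> dim_sub n (W (c - e) k)"
proof -
  have "{y \<in> W e k. S *\<^sub>v y = 0\<^sub>v n} = {0\<^sub>v n}"
  proof safe
    fix y assume "y \<in> W e k" and Sy: "S *\<^sub>v y = 0\<^sub>v n"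
    hence y: "y \<in> cv" "U e *\<^sub>v y = 0\<^sub>v n" by (auto simp: W_iff)
    have "(e * (c - e)) \<cdot>\<^sub>v y = 0\<^sub>v n" using SS_eigen[OF y] Sy by (simp add: vec_simps)
    moreover have "e * (c - e) \<noteq> 0" using assms by simp
    ultimately show "y = 0\<^sub>v n" by (rule smult_vec_eq_0D)
  next
    show "0\<^sub>v n \<in> W e k" using vec_subspace_W by (simp add: vec_subspace_def)
  qed (simp add: vec_simps)
  hence "dim_sub n (W e k) = dim_sub n ((*\<^sub>v) S ` W e k)"
    using dim_sub_mult_mat[OF S vec_subspace_W, of e k] by (simp add: dim_sub_zero)
  also have "\<dots> \<le> dim_sub n (W (c - e) k)"
    by (intro dim_sub_mono vec_subspace_image vec_subspace_W) (auto intro: S_W)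
  finally show ?thesis .
qed

text \<open>
  Now \<open>S\<^sup>2\<close> vanishes on \<open>W e (k + 1)\<close> and on \<open>W (c - e) k\<close>. Rank-nullity splits both dimensions into the
  rank and the nullity of \<open>S\<close>; the rank on the first space is bounded by the nullity on the second and
  the nullity on the first by the rank on the second.
\<close>

lemma dim_sub_W_interlace:
  assumes e: "e = 0 \<or> e = c" and c: "c \<noteq> 0"
  shows "dim_sub n (W e (Suc k)) \<le> dim_sub n (W (c - e) k)"
proof -
  let ?W = "W e (Suc k)" and ?W' = "W (c - e) k" and ?\<kappa> = "c - 2 * e"
  have "?\<kappa> = c \<or> ?\<kappa> = - c"
  proof (cases "e = 0")
    case False
    have "c - (c + c) = - c" by simp
    hence "c - 2 * c = - c" by (simp only: mult_2)
    with False e show ?thesis by blast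
  qed simp
  hence \<kappa>: "?\<kappa> \<noteq> 0" using c by (metis neg_equal_0_iff_equal)
  have U [simp]: "U e \<in> sq" "U (c - e) \<in> sq" by simp_all
  have prod0: "e * (c - e) = 0" using e by auto
  have 1: "(*\<^sub>v) S ` ?W \<subseteq> {y \<in> ?W'. S *\<^sub>v y = 0\<^sub>v n}"
  proof safe
    fix y assume y: "y \<in> ?W"
    have "S *\<^sub>v y \<in> W (c - e) (Suc k)" by (rule S_W[OF y])
    thus "S *\<^sub>v y \<in> ?W'" using deep_ker_antimono[of "U (c - e)" n k] by auto
    show "S *\<^sub>v (S *\<^sub>v y) = 0\<^sub>v n" using SS_eigen[of y e] y prod0
      by (auto simp: W_iff zero_smult_vec)
  qed
  have 2: "{y \<in> ?W. S *\<^sub>v y = 0\<^sub>v n} \<subseteq> (*\<^sub>v) S ` ?W'"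
  proof safe
    fix y assume "y \<in> ?W" and Sy: "S *\<^sub>v y = 0\<^sub>v n"
    then obtain x where y: "y \<in> cv" "U e *\<^sub>v y = 0\<^sub>v n" and x: "x \<in> cv" "y = U e ^\<^sub>m Suc k *\<^sub>v x"
      unfolding W_iff by blast
    have Sx: "S *\<^sub>v x \<in> cv" using x by (simp add: sq_closed)
    \<comment> \<open>One power of \<open>A - e\<close> is set aside: on \<open>t\<close> the matrix \<open>S\<^sup>2\<close> is not yet zero.\<close>
    define t where "t = U e ^\<^sub>m k *\<^sub>v x"
    have t: "t \<in> cv" using x by (simp add: t_def sq_closed)
    have yt: "y = U e *\<^sub>v t" unfolding x(2) t_def by (rule pow_mat_Suc_vec(1)[OF U(1) x(1)])
    have SSt: "S *\<^sub>v (S *\<^sub>v t) = ?\<kappa> \<cdot>\<^sub>v y"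
    proof -
      have "[:0, 1:] * [:c, -1:] = - ([:- (c - e), 1:] * [:-e, 1:])"
        using prod0 by (simp add: algebra_simps)
      hence "S * S = poly_mat A (- [:- (c - e), 1:] * [:-e, 1:])"
        by (metis SS A poly_mat_X poly_mat_mult mult_minus_left)
      hence "S *\<^sub>v (S *\<^sub>v t) = poly_mat A (- [:- (c - e), 1:]) *\<^sub>v (U e *\<^sub>v t)"
        using t by (metis A S U(1) char_matrix_poly_mat poly_mat_closed poly_mat_mult vec_simps(1))
      also have "\<dots> = poly (- [:- (c - e), 1:]) e \<cdot>\<^sub>v y"
        unfolding yt[symmetric] by (rule poly_mat_eigen[OF A y])
      also have "poly (- [:- (c - e), 1:]) e = ?\<kappa>" by simp
      finally show ?thesis .
    qed
    have St: "S *\<^sub>v t \<in> cv" using t by (simp add: sq_closed)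
    \<comment> \<open>As \<open>S\<^sup>2 t = \<kappa> y\<close>, a preimage of \<open>y\<close> is \<open>\<kappa>\<^sup>-\<^sup>1 S t\<close>, which need not be an eigenvector for
      \<open>c - e\<close>. The factor \<open>A - e\<close> kills its component at \<open>e\<close>, at the price of a second factor \<open>\<kappa>\<close>.\<close>
    define z where "z = U e *\<^sub>v (S *\<^sub>v t)"
    have z: "z \<in> cv" using St by (simp add: z_def sq_closed)
    have Sz: "S *\<^sub>v z = (?\<kappa> * ?\<kappa>) \<cdot>\<^sub>v y"
    proof -
      have "S *\<^sub>v z = - 1 \<cdot>\<^sub>v (U (c - e) *\<^sub>v (?\<kappa> \<cdot>\<^sub>v y))"
        unfolding z_def S_U_vec[OF St] SSt ..
      also have "U (c - e) *\<^sub>v (?\<kappa> \<cdot>\<^sub>v y) = ?\<kappa> \<cdot>\<^sub>v (U (c - e) *\<^sub>v y)"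
        using y by (simp add: vec_simps)
      also have "U (c - e) *\<^sub>v y = poly [:- (c - e), 1:] e \<cdot>\<^sub>v y"
        unfolding char_matrix_poly_mat[OF A] by (rule poly_mat_eigen[OF A y])
      finally show ?thesis by (simp add: smult_smult_assoc algebra_simps)
    qed
    have "U (c - e) *\<^sub>v z = 0\<^sub>v n"
    proof -
      have "U (c - e) *\<^sub>v z = U e *\<^sub>v (U (c - e) *\<^sub>v (S *\<^sub>v t))"
        unfolding z_def using St
        by (simp add: char_matrix_poly_mat poly_mat_vec_mult mult.commute)
      also have "U (c - e) *\<^sub>v (S *\<^sub>v t) = - 1 \<cdot>\<^sub>v (S *\<^sub>v (U e *\<^sub>v t))"
        using S_U_vec[OF t, of e] St by (simp add: smult_smult_assoc)
      finally show ?thesis using Sy yt by (simp add: zero_smult_vec vec_simps)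
    qed
    moreover have "z = U (c - e) ^\<^sub>m k *\<^sub>v ((- 1) ^ k \<cdot>\<^sub>v (U e *\<^sub>v (S *\<^sub>v x)))"
    proof -
      have "z = (- 1) ^ k \<cdot>\<^sub>v (U e *\<^sub>v (U (c - e) ^\<^sub>m k *\<^sub>v (S *\<^sub>v x)))"
        unfolding z_def t_def S_U_pow[OF x(1)] using Sx by (simp add: vec_simps sq_closed)
      also have "U e *\<^sub>v (U (c - e) ^\<^sub>m k *\<^sub>v (S *\<^sub>v x)) = U (c - e) ^\<^sub>m k *\<^sub>v (U e *\<^sub>v (S *\<^sub>v x))"
        using Sx by (intro pow_commute_vec) (simp_all add: char_matrix_poly_mat poly_mat_commutes)
      finally show ?thesis using Sx by (simp add: vec_simps sq_closed)
    qed
    moreover have "(- 1) ^ k \<cdot>\<^sub>v (U e *\<^sub>v (S *\<^sub>v x)) \<in> cv" using Sx by (simp add: sq_closed)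
    ultimately have "z \<in> ?W'" using z unfolding W_iff by blast
    hence "inverse (?\<kappa> * ?\<kappa>) \<cdot>\<^sub>v z \<in> ?W'" using vec_subspace_W unfolding vec_subspace_def by blast
    moreover have "y = S *\<^sub>v (inverse (?\<kappa> * ?\<kappa>) \<cdot>\<^sub>v z)"
    proof -
      have "inverse (?\<kappa> * ?\<kappa>) * (?\<kappa> * ?\<kappa>) = 1" by (rule left_inverse) (use \<kappa> in simp)
      thus ?thesis unfolding vec_simps(7)[OF S z] Sz smult_smult_assoc by simp
    qed
    ultimately show "y \<in> (*\<^sub>v) S ` ?W'" by blast
  qed
  have "dim_sub n ?W = dim_sub n ((*\<^sub>v) S ` ?W) + dim_sub n {y \<in> ?W. S *\<^sub>v y = 0\<^sub>v n}"
    by (rule dim_sub_mult_mat[OF S vec_subspace_W])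
  also have "\<dots> \<le> dim_sub n {y \<in> ?W'. S *\<^sub>v y = 0\<^sub>v n} + dim_sub n ((*\<^sub>v) S ` ?W')"
    by (intro add_mono dim_sub_mono vec_subspace_image vec_subspace_ker vec_subspace_W S 1 2)
  also have "\<dots> = dim_sub n ?W'" using dim_sub_mult_mat[OF S vec_subspace_W, of "c - e" k] by simp
  finally show ?thesis .
qed

end

lemma skew_root_ac:
  assumes "skew_root n A S c"
  shows "skew_root n (mat_ac A) (mat_ac S) (to_ac c)"
proof -
  interpret skew_root n A S c by fact
  have r: "map_poly to_ac [:c, -1:] = [:to_ac c, -1:]" by simp
  show ?thesis
  proof
    show "mat_ac S * mat_ac A = poly_mat (mat_ac A) [:to_ac c, -1:] * mat_ac S"
      using arg_cong[OF SA, of mat_ac] by (simp add: mat_ac_mult mat_ac_poly_mat r del: to_ac_hom.map_poly_pCons_hom)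
    show "mat_ac S * mat_ac S = mat_ac A * poly_mat (mat_ac A) [:to_ac c, -1:]"
      using arg_cong[OF SS, of mat_ac] by (simp add: mat_ac_mult mat_ac_poly_mat r del: to_ac_hom.map_poly_pCons_hom)
  qed auto
qed

section \<open>Construction of a skew root from the block numbers\<close>

context square
begin

text \<open>
  With \<open>F\<close> the projection onto an \<open>A\<close>-invariant summand, this is the number of Jordan blocks for \<open>e\<close> of
  size at least \<open>k + 1\<close> of the restriction of \<open>A\<close> to the summand.
\<close>

definition deep_dim :: "'a::field mat \<Rightarrow> 'a mat \<Rightarrow> 'a alg_closure \<Rightarrow> nat \<Rightarrow> nat" where
  "deep_dim A F e k = dim_sub n (deep_ker n (char_matrix (mat_ac A) e) k (mat_ac F))"

text \<open>
  The conditions of the theorem in terms of numbers \<open>N e k\<close> of blocks of size at least \<open>k + 1\<close>.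
\<close>

definition balanced :: "'a::field \<Rightarrow> ('a alg_closure \<Rightarrow> nat \<Rightarrow> nat) \<Rightarrow> bool" where
  "balanced c N \<longleftrightarrow> (\<forall>e k. e \<notin> {0, to_ac c} \<longrightarrow> N e k = N (to_ac c - e) k) \<and>
     (\<forall>k. N 0 (Suc k) \<le> N (to_ac c) k \<and> N (to_ac c) (Suc k) \<le> N 0 k)"

text \<open>
  Here \<open>N\<close> counts the blocks of a module, \<open>ord e\<close> is the size of its largest block for \<open>e\<close>, and \<open>N'\<close>
  counts the blocks that remain when one largest block is removed for each \<open>e\<close>. The first three claims
  hold because \<open>N e k\<close> is positive exactly for \<open>k < ord e\<close>. The removal lowers \<open>N e k\<close> by one for
  \<open>k < ord e\<close>. The interlacing inequality could break only where the larger side is lowered and the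
  smaller side is not, but there \<open>k + 1\<close> has already reached the order on the smaller side, which is
  therefore zero.
\<close>

lemma balanced_top_order:
  fixes N N' :: "'a::field alg_closure \<Rightarrow> nat \<Rightarrow> nat"
  assumes N: "balanced c N" and split: "\<And>e k. N e k = (if k < ord e then 1 else 0) + N' e k"
    and van: "\<And>e k. ord e \<le> k \<Longrightarrow> N' e k = 0"
  shows "e \<notin> {0, to_ac c} \<Longrightarrow> ord e = ord (to_ac c - e)"
    and "ord (to_ac c) \<le> Suc (ord 0)" and "ord 0 \<le> Suc (ord (to_ac c))"
    and "balanced c N'"
proof -
  have pos: "N e k > 0 \<longleftrightarrow> k < ord e" for e k using split[of e k] van[of e k] by auto
  show sym: "ord e = ord (to_ac c - e)" if "e \<notin> {0, to_ac c}" for e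
  proof -
    have "k < ord e \<longleftrightarrow> k < ord (to_ac c - e)" for k
      using N that pos[of e k] pos[of "to_ac c - e" k] by (simp add: balanced_def)
    thus ?thesis by (metis linorder_neqE_nat less_irrefl)
  qed
  have near: "N 0 (Suc k) \<le> N (to_ac c) k" "N (to_ac c) (Suc k) \<le> N 0 k" for k
    using N by (auto simp: balanced_def)
  show c0: "ord (to_ac c) \<le> Suc (ord 0)"
  proof (rule ccontr)
    assume "\<not> ?thesis"
    hence "N (to_ac c) (Suc (ord 0)) > 0" by (simp add: pos)
    with near(2)[of "ord 0"] pos[of 0 "ord 0"] show False by simp
  qed
  show 0: "ord 0 \<le> Suc (ord (to_ac c))"
  proof (rule ccontr)
    assume "\<not> ?thesis"
    hence "N 0 (Suc (ord (to_ac c))) > 0" by (simp add: pos)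
    with near(1)[of "ord (to_ac c)"] pos[of "to_ac c" "ord (to_ac c)"] show False by simp
  qed
  show "balanced c N'"
    unfolding balanced_def
  proof (intro conjI allI impI)
    fix e k assume e: "e \<notin> {0, to_ac c}"
    hence "N e k = N (to_ac c - e) k" using N by (simp add: balanced_def)
    thus "N' e k = N' (to_ac c - e) k" using sym[OF e] split[of e k] split[of "to_ac c - e" k] by simp
  next
    fix k
    show "N' 0 (Suc k) \<le> N' (to_ac c) k"
      using near(1)[of k] split[of 0 "Suc k"] split[of "to_ac c" k] van[of 0 "Suc k"] 0
      by (cases "Suc k < ord 0"; cases "k < ord (to_ac c)") auto
    show "N' (to_ac c) (Suc k) \<le> N' 0 k"
      using near(2)[of k] split[of "to_ac c" "Suc k"] split[of 0 k] van[of "to_ac c" "Suc k"] c0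
      by (cases "Suc k < ord (to_ac c)"; cases "k < ord 0") auto
  qed
qed

text \<open>
  A cyclic summand \<open>E\<close> with the largest annihilator \<open>d\<close> is split off from \<open>F\<close>. Its blocks are the
  largest ones of \<open>F\<close>, because the blocks of the complement \<open>F - E\<close> are bounded by the orders of \<open>d\<close> as
  well. Hence \<open>E\<close> has a skew root, \<open>F - E\<close> has one by induction, and the two add up.
\<close>

lemma skew_root_on_summand:
  fixes A F :: "'a::field mat"
  assumes A: "A \<in> sq"
  shows "F \<in> sq \<Longrightarrow> F * F = F \<Longrightarrow> A * F = F * A \<Longrightarrow> balanced c (deep_dim A F) \<Longrightarrow>
    \<exists>S\<in>sq. F * S = S \<and> S * F = S \<and> S * A = poly_mat A [:c, -1:] * S \<and> S * S = A * poly_mat A [:c, -1:] * F"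
proof (induction "dim_sub n ((*\<^sub>v) F ` cv)" arbitrary: F rule: less_induct)
  case less
  note F = less.prems(1) and FF = less.prems(2) and AF = less.prems(3) and bal = less.prems(4)
  let ?C = "poly_mat A [:c, -1:]"
  have C: "?C \<in> sq" using A by simp
  show ?case
  proof (cases "F = 0\<^sub>m n n")
    case True
    thus ?thesis using A C by (intro bexI[of _ "0\<^sub>m n n"]) (simp_all add: sq_simps)
  next
    case False
    obtain v w d where cyc: "cyclic_pair n A v w d" and Fv: "F *\<^sub>v v = v"
      and wF: "outer v w * F = outer v w" and dF: "poly_mat A d * F = 0\<^sub>m n n"
      using cyclic_pair_exists[OF A F AF FF False] by blast
    interpret Z: cyclic_pair n A v w d by (rule cyc)
    interpret L: cyclic_pair n "mat_ac A" "map_vec to_ac v" "map_vec to_ac w" "map_poly to_ac d"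
      by (rule Z.cyclic_pair_ac)
    define E where "E = Z.proj"
    have E: "E \<in> sq" and EE: "E * E = E" and AE: "A * E = E * A"
      by (simp_all add: E_def Z.proj_closed Z.proj_idem Z.proj_commute)
    have EF: "E * F = E"
      unfolding E_def Z.proj_def by (rule bezoutian_mult_right[OF A _ A F AF wF]) auto
    have FE: "F * E = E"
    proof (rule mat_eq_vecI)
      fix x :: "'a vec" assume x: "x \<in> cv"
      then obtain f where f: "E *\<^sub>v x = poly_mat A f *\<^sub>v v" using Z.proj_range E_def by metis
      have "F *\<^sub>v (poly_mat A f *\<^sub>v v) = poly_mat A f *\<^sub>v (F *\<^sub>v v)"
        using poly_mat_commute[OF A F AF, of f] A F by (metis Z.v poly_mat_closed vec_simps(1))
      thus "F * E *\<^sub>v x = E *\<^sub>v x" using x F E by (simp add: vec_simps f Fv)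
    qed (use F E in auto)
    let ?G = "F - E"
    have G: "?G \<in> sq" using F E by auto
    have GG: "?G * ?G = ?G" and AG: "A * ?G = ?G * A" and EG: "E * ?G = 0\<^sub>m n n" and GE: "?G * E = 0\<^sub>m n n"
      and FG: "F * ?G = ?G" and GF: "?G * F = ?G"
      using A F E by (simp_all add: sq_simps FF EE EF FE AF AE)
        (rule sq_eqI; simp add: sq_index del: index_mult_mat(1))+
    define ord where "ord = (\<lambda>e. order e (map_poly to_ac d))"
    have mE: "mat_ac E = L.proj" unfolding E_def by (rule Z.mat_ac_proj)
    have split: "deep_dim A F e k = (if k < ord e then 1 else 0) + deep_dim A ?G e k" for e k
    proof -
      let ?U = "char_matrix (mat_ac A) e"
      have com: "?U * mat_ac M = mat_ac M * ?U" if M: "M \<in> sq" "A * M = M * A" for M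
      proof -
        have "mat_ac A * mat_ac M = mat_ac M * mat_ac A"
          using A M mat_ac_mult[of A M] mat_ac_mult[of M A] by metis
        thus ?thesis using A M by (simp add: char_matrix_poly_mat poly_mat_commute)
      qed
      have hom: "mat_ac M * mat_ac M' = mat_ac M''" if "M * M' = M''" "M \<in> sq" "M' \<in> sq" for M M' M''
        using that mat_ac_mult by metis
      have "deep_dim A F e k = dim_sub n (deep_ker n ?U k (mat_ac E)) + dim_sub n (deep_ker n ?U k (mat_ac F - mat_ac E))"
        unfolding deep_dim_def
        by (rule dim_sub_deep_ker_split) (use A F E in \<open>simp_all add: com AF AE hom[OF FF] hom[OF EE] hom[OF EF] hom[OF FE]\<close>)
      thus ?thesis
        unfolding deep_dim_def mat_ac_diff[OF F E] mE L.dim_sub_deep_ker_proj ord_def .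
    qed
    have van: "deep_dim A ?G e k = 0" if "ord e \<le> k" for e k
    proof -
      have "poly_mat A d * E = 0\<^sub>m n n" unfolding E_def by (rule Z.d_proj)
      hence "poly_mat A d * ?G = 0\<^sub>m n n - 0\<^sub>m n n" using A F E dF by (simp add: sq_simps)
      also have "\<dots> = 0\<^sub>m n n" by (rule eq_matI) auto
      finally have "poly_mat A d * ?G = 0\<^sub>m n n" .
      hence "mat_ac (poly_mat A d * ?G) = 0\<^sub>m n n" by (simp add: mat_ac_zero)
      hence "poly_mat (mat_ac A) (map_poly to_ac d) * mat_ac ?G = 0\<^sub>m n n"
        using A G by (simp add: mat_ac_mult mat_ac_poly_mat)
      moreover have "map_poly to_ac d \<noteq> 0" using L.deg by auto
      ultimately have "deep_ker n (char_matrix (mat_ac A) e) k (mat_ac ?G) = {0\<^sub>v n}"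
        using that G unfolding ord_def by (intro deep_ker_beyond_order[OF L.A]) auto
      thus ?thesis by (simp add: deep_dim_def dim_sub_zero)
    qed
    note top = balanced_top_order[OF bal split van]
    have "d \<noteq> 0" using Z.deg by auto
    then obtain g where g: "g * (g \<circ>\<^sub>p [:c, -1:]) = [:0, 1:] * [:c, -1:]" "d dvd g * (d \<circ>\<^sub>p [:c, -1:])"
      using skew_divisor_exists[of d c] top(1-3) unfolding ord_def by blast
    obtain S1 where S1: "S1 \<in> sq" "E * S1 = S1" "S1 * E = S1" "S1 * A = ?C * S1" "S1 * S1 = A * ?C * E"
      using Z.skew_root_exists[OF g] unfolding E_def by blast
    \<comment> \<open>The image of \<open>F - E\<close> lies in the kernel of \<open>E\<close> on the image of \<open>F\<close>, and \<open>E\<close> does not vanish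
      there since it fixes \<open>v\<close>.\<close>
    have "dim_sub n ((*\<^sub>v) ?G ` cv) < dim_sub n ((*\<^sub>v) F ` cv)"
    proof -
      have cvs: "vec_subspace n cv" by (auto simp: vec_subspace_def)
      have sF: "vec_subspace n ((*\<^sub>v) F ` cv)" by (rule vec_subspace_image[OF F cvs])
      have "(*\<^sub>v) ?G ` cv \<subseteq> {y \<in> (*\<^sub>v) F ` cv. E *\<^sub>v y = 0\<^sub>v n}"
      proof safe
        fix x :: "'a vec" assume x: "x \<in> cv"
        have "?G *\<^sub>v x = F *\<^sub>v (?G *\<^sub>v x)" using FG x F G by (metis vec_simps(1))
        thus "?G *\<^sub>v x \<in> (*\<^sub>v) F ` cv" using x G by (metis imageI sq_closed(2))
        show "E *\<^sub>v (?G *\<^sub>v x) = 0\<^sub>v n" using EG x E G by (metis vec_simps(1) vec_simps(8))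
      qed
      hence "dim_sub n ((*\<^sub>v) ?G ` cv) \<le> dim_sub n {y \<in> (*\<^sub>v) F ` cv. E *\<^sub>v y = 0\<^sub>v n}"
        by (intro dim_sub_mono vec_subspace_image vec_subspace_ker sF cvs E G)
      moreover have "dim_sub n ((*\<^sub>v) E ` (*\<^sub>v) F ` cv) > 0"
      proof -
        have Ev: "E *\<^sub>v v = v" using Z.proj_poly_mat[of 1] by (simp add: E_def vec_simps)
        have "range (\<lambda>a. a \<cdot>\<^sub>v v) \<subseteq> (*\<^sub>v) E ` (*\<^sub>v) F ` cv"
        proof safe
          fix a
          have "a \<cdot>\<^sub>v v = E *\<^sub>v (F *\<^sub>v (a \<cdot>\<^sub>v v))" using E F by (simp add: vec_simps Fv Ev)
          thus "a \<cdot>\<^sub>v v \<in> (*\<^sub>v) E ` (*\<^sub>v) F ` cv" by (metis Z.v imageI smult_carrier_vec)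
        qed
        hence le: "dim_sub n (range (\<lambda>a. a \<cdot>\<^sub>v v)) \<le> dim_sub n ((*\<^sub>v) E ` (*\<^sub>v) F ` cv)"
          by (intro dim_sub_mono vec_subspace_image[OF E sF] vec_subspace_range) auto
        have "\<not> d dvd 1" using Z.deg by (auto simp: is_unit_iff_degree)
        hence "v \<noteq> 0\<^sub>v n" using Z.poly_mat_v_eq_0_iff[of 1] by (simp add: vec_simps)
        hence "dim_sub n (range (\<lambda>a. a \<cdot>\<^sub>v v)) = 1" by (intro dim_sub_line) auto
        with le show ?thesis by simp
      qed
      ultimately show ?thesis using dim_sub_mult_mat[OF E sF] by simp
    qed
    from less.hyps[OF this G GG AG top(4)]
    obtain S2 where S2: "S2 \<in> sq" "?G * S2 = S2" "S2 * ?G = S2" "S2 * A = ?C * S2" "S2 * S2 = A * ?C * ?G"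
      by blast
    have cross: "S1 * S2 = 0\<^sub>m n n" "S2 * S1 = 0\<^sub>m n n"
    proof -
      have "S1 * S2 = S1 * (E * ?G) * S2" using S1 S2 E G by (metis sq_closed(1) sq_simps(1))
      thus "S1 * S2 = 0\<^sub>m n n" unfolding EG using S1 S2 by (simp add: sq_simps)
      have "S2 * S1 = S2 * (?G * E) * S1" using S1 S2 E G by (metis sq_closed(1) sq_simps(1))
      thus "S2 * S1 = 0\<^sub>m n n" unfolding GE using S1 S2 by (simp add: sq_simps)
    qed
    have FS: "F * S1 = S1" "S1 * F = S1" "F * S2 = S2" "S2 * F = S2"
      using S1 S2 E F G FE EF FG GF by (metis sq_simps(1))+
    show ?thesis
    proof (intro bexI[of _ "S1 + S2"] conjI)
      show "F * (S1 + S2) = S1 + S2" "(S1 + S2) * F = S1 + S2"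
        using F S1(1) S2(1) by (simp_all add: sq_simps FS)
      show "(S1 + S2) * A = ?C * (S1 + S2)"
        using A C S1(1,4) S2(1,4) by (simp add: sq_simps)
      have "(S1 + S2) * (S1 + S2) = (S1 * S1 + 0\<^sub>m n n) + (0\<^sub>m n n + S2 * S2)"
        using S1(1) S2(1) by (simp add: sq_simps cross)
      also have "\<dots> = A * ?C * E + A * ?C * ?G" unfolding S1(5) S2(5) using A C E G by simp
      also have "\<dots> = A * ?C * F"
        using A C E F by (simp add: sq_simps) (rule sq_eqI; simp add: sq_index del: index_mult_mat(1))
      finally show "(S1 + S2) * (S1 + S2) = A * ?C * F" .
    qed (use S1 S2 in auto)
  qed
qed

lemma skew_root_iff_balanced:
  fixes A :: "'a::field mat"
  assumes A: "A \<in> sq" and c: "c \<noteq> 0"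
  shows "(\<exists>S\<in>sq. S * A = poly_mat A [:c, -1:] * S \<and> S * S = A * poly_mat A [:c, -1:]) \<longleftrightarrow>
    balanced c (deep_dim A (1\<^sub>m n))"
proof
  assume "\<exists>S\<in>sq. S * A = poly_mat A [:c, -1:] * S \<and> S * S = A * poly_mat A [:c, -1:]"
  then obtain S where "skew_root n A S c" using A by (auto intro!: skew_root.intro)
  then interpret skew_root n "mat_ac A" "mat_ac S" "to_ac c" by (rule skew_root_ac)
  have "dim_sub n (W e k) = dim_sub n (W (to_ac c - e) k)" if "e \<notin> {0, to_ac c}" for e k
    using that dim_sub_W_reflect[of e k] dim_sub_W_reflect[of "to_ac c - e" k] by fastforce
  thus "balanced c (deep_dim A (1\<^sub>m n))"
    using dim_sub_W_interlace[of 0] dim_sub_W_interlace[of "to_ac c"] c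
    unfolding balanced_def deep_dim_def to_ac_hom.mat_hom_one by simp
next
  assume "balanced c (deep_dim A (1\<^sub>m n))"
  from skew_root_on_summand[OF A _ _ _ this] A
  show "\<exists>S\<in>sq. S * A = poly_mat A [:c, -1:] * S \<and> S * S = A * poly_mat A [:c, -1:]"
    by (force simp: sq_simps)
qed

end

theorem theorem3:
  fixes \<alpha> :: "'a::field" and n :: nat and A :: "'a mat"
  assumes "CHAR('a) \<noteq> 2"
    and "\<alpha> \<noteq> 0"
    and "n \<ge> 1"
    and "A \<in> carrier_mat n n"
  shows "mat_composite n \<alpha> \<alpha> A \<longleftrightarrow>
    intertwined (\<lambda>k. nblocks_ge k A 0) (\<lambda>k. nblocks_ge k A (to_ac (2 * \<alpha>))) \<and>
    (\<forall>ev. ev \<notin> {0, to_ac \<alpha>, to_ac (2 * \<alpha>)} \<longrightarrow>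
       (\<forall>k\<ge>1. nblocks_eq k A ev = nblocks_eq k A (to_ac (2 * \<alpha>) - ev)))"
proof -
  interpret square n .
  let ?c = "2 * \<alpha>"
  have two: "(2::'a) \<noteq> 0"
  proof
    assume "(2::'a) = 0"
    hence "CHAR('a) dvd 2" using of_nat_eq_0_iff_char_dvd[of 2, where 'a = 'a] by simp
    hence "CHAR('a) = 1" using assms(1) by (metis dvd_imp_le le_antisym not_less_eq_eq numeral_2_eq_2 One_nat_def CHAR_not_1' prime_nat_iff two_is_prime_nat)
    thus False by simp
  qed
  have A: "A \<in> sq" by fact
  have "mat_ac A \<in> carrier_mat n n" using A by simp
  then obtain bs where bs: "jordan_nf (mat_ac A) bs" using jordan_nf_alg_closed by blast
  have N: "deep_dim A (1\<^sub>m n) e k = nblocks_ge (Suc k) A e" for e k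
    by (simp add: deep_dim_def nblocks_ge_Suc[OF A] to_ac_hom.mat_hom_one)
  have all: "(\<forall>k\<ge>1. P k) \<longleftrightarrow> (\<forall>k. P (Suc k))" for P :: "nat \<Rightarrow> bool"
    by (metis Suc_le_D Suc_le_mono le0 One_nat_def)
  have "mat_composite n \<alpha> \<alpha> A \<longleftrightarrow> balanced ?c (deep_dim A (1\<^sub>m n))"
    using mat_composite_iff_skew_root[OF A two assms(2)] skew_root_iff_balanced[OF A, of ?c] two assms(2)
    by simp
  also have "\<dots> \<longleftrightarrow>
    intertwined (\<lambda>k. nblocks_ge k A 0) (\<lambda>k. nblocks_ge k A (to_ac ?c)) \<and>
    (\<forall>ev. ev \<notin> {0, to_ac ?c} \<longrightarrow>
       (\<forall>k. nblocks_ge (Suc k) A ev = nblocks_ge (Suc k) A (to_ac ?c - ev)))"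
    unfolding balanced_def N intertwined_def all by auto
  also have "\<dots> \<longleftrightarrow>
    intertwined (\<lambda>k. nblocks_ge k A 0) (\<lambda>k. nblocks_ge k A (to_ac ?c)) \<and>
    (\<forall>ev. ev \<notin> {0, to_ac \<alpha>, to_ac ?c} \<longrightarrow>
       (\<forall>k\<ge>1. nblocks_eq k A ev = nblocks_eq k A (to_ac ?c - ev)))"
  proof -
    \<comment> \<open>At the fixed point \<open>\<alpha>\<close> of the reflection the condition is trivial.\<close>
    have "to_ac ?c - to_ac \<alpha> = to_ac \<alpha>" by simp
    thus ?thesis unfolding nblocks_eq_iff_nblocks_ge[OF A bs] by (metis insert_iff)
  qed
  finally show ?thesis .
qed

end
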